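(* Let $\Omega\subseteq\mathbb R^d$ be open and non-empty, equipped with Lebesgue measure. Let $A$ be the unbounded self-adjoint operator on $L^2(\Omega)$ associated to the form $a:H^1_0(\Omega)\times H^1_0(\Omega)\to\mathbb C$, $$a(u,v)=\int_\Omega\sum_{j,k=1}^da_{kj}\,\partial_ku\,\overline{\partial_jv}\,dx,$$ where $a_{kj}=a_{jk}:\Omega\to\mathbb R$ are bounded measurable functions such that the principal part is elliptic, i.e. there exists a constant $\eta>0$ with $$\sum_{j,k=1}^da_{kj}(x)\xi_j\overline{\xi_k}\ge\eta|\xi|^2\qquad(\xi\in\mathbb C^d,\ \text{a.e. }x\in\Omega).$$ Let $\delta>2$. Then for any $f\in D(A^\delta)$, $$\exp(itA)f(x)\to f(x)\quad\text{as }t\to0+,\ \text{for a.e. }x\in\Omega.$$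
   Context: $H^1_0(\Omega)$ is the closure of $C_c^\infty(\Omega)$ in the Sobolev space $H^1(\Omega)$. The operator associated to the form is $Au=g$ for $u\in D(A)$, where $D(A)$ is the set of $u\in H^1_0(\Omega)$ for which there is $g\in L^2(\Omega)$ with $a(u,v)=\langle g,v\rangle$ for all $v\in H^1_0(\Omega)$. $\exp(itA)$ and $A^\delta$ are defined by the self-adjoint functional calculus. The pointwise convergence is understood for representatives of $\exp(itA)f\in L^2(\Omega)$ chosen so that for a.e. $x$ the function $t\mapsto\exp(itA)f(x)$ is continuous. *)

theory Defs
  imports "HOL-Analysis.Analysis"
begin

section \<open>The Hilbert space L2\<close>

text \<open>Elements of L2 are represented by functions; two representatives denote the same
  element iff they agree almost everywhere. All notions below are invariant under changing
  representatives on null sets.\<close>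

definition L2 :: "'a measure \<Rightarrow> ('a \<Rightarrow> complex) set" where
  "L2 M = {f \<in> borel_measurable M. integrable M (\<lambda>x. (cmod (f x))\<^sup>2)}"

definition L2_inner :: "'a measure \<Rightarrow> ('a \<Rightarrow> complex) \<Rightarrow> ('a \<Rightarrow> complex) \<Rightarrow> complex" where
  "L2_inner M f g = (\<integral>x. f x * cnj (g x) \<partial>M)"

definition L2_norm :: "'a measure \<Rightarrow> ('a \<Rightarrow> complex) \<Rightarrow> real" where
  "L2_norm M f = sqrt (\<integral>x. (cmod (f x))\<^sup>2 \<partial>M)"

definition L2_eq :: "'a measure \<Rightarrow> ('a \<Rightarrow> complex) \<Rightarrow> ('a \<Rightarrow> complex) \<Rightarrow> bool" where
  "L2_eq M f g \<longleftrightarrow> (AE x in M. f x = g x)"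


section \<open>Self-adjoint functional calculus\<close>

text \<open>Unbounded operators on L2 are represented by their graphs, i.e. sets of pairs of
  representatives; the domain of an operator is the \<^const>\<open>Domain\<close> of its graph.\<close>

type_synonym 'a operator = "(('a \<Rightarrow> complex) \<times> ('a \<Rightarrow> complex)) set"

definition orthogonal_projection ::
    "'a measure \<Rightarrow> (('a \<Rightarrow> complex) \<Rightarrow> ('a \<Rightarrow> complex)) \<Rightarrow> bool" where
  "orthogonal_projection M P \<longleftrightarrow>
     (\<forall>f\<in>L2 M. P f \<in> L2 M) \<and>
     (\<forall>f\<in>L2 M. \<forall>g\<in>L2 M. L2_eq M f g \<longrightarrow> L2_eq M (P f) (P g)) \<and>
     (\<forall>f\<in>L2 M. \<forall>g\<in>L2 M. L2_eq M (P (\<lambda>x. f x + g x)) (\<lambda>x. P f x + P g x)) \<and>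
     (\<forall>c. \<forall>f\<in>L2 M. L2_eq M (P (\<lambda>x. c * f x)) (\<lambda>x. c * P f x)) \<and>
     (\<forall>f\<in>L2 M. L2_eq M (P (P f)) (P f)) \<and>
     (\<forall>f\<in>L2 M. \<forall>g\<in>L2 M. L2_inner M (P f) g = L2_inner M f (P g))"

definition projection_valued_measure ::
    "'a measure \<Rightarrow> (real set \<Rightarrow> ('a \<Rightarrow> complex) \<Rightarrow> ('a \<Rightarrow> complex)) \<Rightarrow> bool" where
  "projection_valued_measure M E \<longleftrightarrow>
     (\<forall>B\<in>sets borel. orthogonal_projection M (E B)) \<and>
     (\<forall>f\<in>L2 M. L2_eq M (E UNIV f) f) \<and>
     (\<forall>B\<in>sets borel. \<forall>C\<in>sets borel. \<forall>f\<in>L2 M. L2_eq M (E (B \<inter> C) f) (E B (E C f))) \<and>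
     (\<forall>B :: nat \<Rightarrow> real set. range B \<subseteq> sets borel \<longrightarrow> disjoint_family B \<longrightarrow>
        (\<forall>f\<in>L2 M. \<forall>g\<in>L2 M.
           (\<lambda>n. L2_inner M (E (B n) f) g) sums L2_inner M (E (\<Union>n. B n) f) g))"

text \<open>The finite Borel measure that maps B to the real number (E(B) f, f).\<close>

definition scalar_spectral_measure ::
    "'a measure \<Rightarrow> (real set \<Rightarrow> ('a \<Rightarrow> complex) \<Rightarrow> ('a \<Rightarrow> complex)) \<Rightarrow> ('a \<Rightarrow> complex) \<Rightarrow> real measure"
  where
  "scalar_spectral_measure M E f =
     measure_of UNIV (sets borel) (\<lambda>B. ennreal (Re (L2_inner M (E B f) f)))"

definition simple_spectral_integral ::
    "(real set \<Rightarrow> ('a \<Rightarrow> complex) \<Rightarrow> ('a \<Rightarrow> complex)) \<Rightarrow> (real \<Rightarrow> complex) \<Rightarrow>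
     ('a \<Rightarrow> complex) \<Rightarrow> ('a \<Rightarrow> complex)" where
  "simple_spectral_integral E s f = (\<lambda>x. \<Sum>c\<in>range s. c * E (s -` {c}) f x)"

text \<open>The (generally unbounded) operator given by the integral of F with respect to E. Its domain
  consists of those f for which F is square integrable with respect to the scalar spectral measure
  of f. Its values are the L2 limits of the integrals of simple functions s n approximating F in
  the L2 space of that measure; by the isometry between the two L2 spaces, the limit does not
  depend on the approximating sequence.\<close>

definition spectral_integral ::
    "'a measure \<Rightarrow> (real set \<Rightarrow> ('a \<Rightarrow> complex) \<Rightarrow> ('a \<Rightarrow> complex)) \<Rightarrow> (real \<Rightarrow> complex) \<Rightarrow> 'a operator"
  where
  "spectral_integral M E F =
     {(f, g). f \<in> L2 M \<and> g \<in> L2 M \<and> F \<in> L2 (scalar_spectral_measure M E f) \<and>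
        (\<exists>s. (\<forall>n::nat. simple_function borel (s n)) \<and>
             (\<lambda>n. L2_norm (scalar_spectral_measure M E f) (\<lambda>r. F r - s n r)) \<longlonglongrightarrow> 0 \<and>
             (\<lambda>n. L2_norm M (\<lambda>x. g x - simple_spectral_integral E (s n) f x)) \<longlonglongrightarrow> 0)}"

definition spectral_resolution ::
    "'a measure \<Rightarrow> 'a operator \<Rightarrow> (real set \<Rightarrow> ('a \<Rightarrow> complex) \<Rightarrow> ('a \<Rightarrow> complex)) \<Rightarrow> bool" where
  "spectral_resolution M A E \<longleftrightarrow>
     projection_valued_measure M E \<and> A = spectral_integral M E complex_of_real"

text \<open>F(A). By the spectral theorem a self-adjoint A has a spectral resolution, and it is unique up
  to equality almost everywhere; the existential quantifier thus expresses a definite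
  description.\<close>

definition functional_calculus ::
    "'a measure \<Rightarrow> 'a operator \<Rightarrow> (real \<Rightarrow> complex) \<Rightarrow> 'a operator" where
  "functional_calculus M A F =
     {(f, g). \<exists>E. spectral_resolution M A E \<and> (f, g) \<in> spectral_integral M E F}"

text \<open>This is used only for non-negative A, whose spectral resolution vanishes on the negative
  half-line, so the value chosen for negative arguments is immaterial.\<close>

definition fractional_power :: "'a measure \<Rightarrow> 'a operator \<Rightarrow> real \<Rightarrow> 'a operator" where
  "fractional_power M A \<delta> =
     functional_calculus M A (\<lambda>r. complex_of_real (if 0 \<le> r then r powr \<delta> else 0))"

definition unitary_group :: "'a measure \<Rightarrow> 'a operator \<Rightarrow> real \<Rightarrow> 'a operator" where
  "unitary_group M A t =
     functional_calculus M A (\<lambda>r. exp (\<i> * complex_of_real t * complex_of_real r))"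


section \<open>Sobolev spaces\<close>

definition partial_deriv :: "'d::finite \<Rightarrow> (real ^ 'd \<Rightarrow> complex) \<Rightarrow> real ^ 'd \<Rightarrow> complex" where
  "partial_deriv k f x = frechet_derivative f (at x) (axis k 1)"

fun C_times :: "nat \<Rightarrow> (real ^ 'd::finite \<Rightarrow> complex) \<Rightarrow> bool" where
  "C_times 0 f \<longleftrightarrow> continuous_on UNIV f"
| "C_times (Suc n) f \<longleftrightarrow> (\<forall>x. f differentiable (at x)) \<and> (\<forall>k. C_times n (partial_deriv k f))"

text \<open>Test functions on \<open>\<Omega>\<close>, extended by zero to the whole space.\<close>

definition test_functions :: "(real ^ 'd::finite) set \<Rightarrow> (real ^ 'd \<Rightarrow> complex) set" where
  "test_functions \<Omega> =
     {\<phi>. (\<forall>n. C_times n \<phi>) \<and> compact (closure {x. \<phi> x \<noteq> 0}) \<and> closure {x. \<phi> x \<noteq> 0} \<subseteq> \<Omega>}"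

definition is_weak_deriv ::
    "(real ^ 'd::finite) set \<Rightarrow> 'd \<Rightarrow> (real ^ 'd \<Rightarrow> complex) \<Rightarrow> (real ^ 'd \<Rightarrow> complex) \<Rightarrow> bool" where
  "is_weak_deriv \<Omega> k u w \<longleftrightarrow>
     (\<forall>\<phi>\<in>test_functions \<Omega>.
        (\<integral>x. u x * partial_deriv k \<phi> x \<partial>lebesgue_on \<Omega>) = - (\<integral>x. w x * \<phi> x \<partial>lebesgue_on \<Omega>))"

definition H1 :: "(real ^ 'd::finite) set \<Rightarrow> (real ^ 'd \<Rightarrow> complex) set" where
  "H1 \<Omega> = {u \<in> L2 (lebesgue_on \<Omega>). \<forall>k. \<exists>w \<in> L2 (lebesgue_on \<Omega>). is_weak_deriv \<Omega> k u w}"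

text \<open>For \<open>u\<close> in H1 this is determined up to equality almost everywhere on \<open>\<Omega>\<close>.\<close>

definition weak_deriv ::
    "(real ^ 'd::finite) set \<Rightarrow> 'd \<Rightarrow> (real ^ 'd \<Rightarrow> complex) \<Rightarrow> real ^ 'd \<Rightarrow> complex" where
  "weak_deriv \<Omega> k u = (SOME w. w \<in> L2 (lebesgue_on \<Omega>) \<and> is_weak_deriv \<Omega> k u w)"

definition H1_norm :: "(real ^ 'd::finite) set \<Rightarrow> (real ^ 'd \<Rightarrow> complex) \<Rightarrow> real" where
  "H1_norm \<Omega> u =
     sqrt ((L2_norm (lebesgue_on \<Omega>) u)\<^sup>2 + (\<Sum>k\<in>UNIV. (L2_norm (lebesgue_on \<Omega>) (weak_deriv \<Omega> k u))\<^sup>2))"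

definition H1_0 :: "(real ^ 'd::finite) set \<Rightarrow> (real ^ 'd \<Rightarrow> complex) set" where
  "H1_0 \<Omega> = {u \<in> H1 \<Omega>. \<forall>\<epsilon>>0. \<exists>\<phi>\<in>test_functions \<Omega>. H1_norm \<Omega> (\<lambda>x. u x - \<phi> x) < \<epsilon>}"


section \<open>The form and its operator\<close>

definition elliptic_form ::
    "(real ^ 'd::finite) set \<Rightarrow> ('d \<Rightarrow> 'd \<Rightarrow> real ^ 'd \<Rightarrow> real) \<Rightarrow>
     (real ^ 'd \<Rightarrow> complex) \<Rightarrow> (real ^ 'd \<Rightarrow> complex) \<Rightarrow> complex" where
  "elliptic_form \<Omega> a u v =
     (\<integral>x. (\<Sum>j\<in>UNIV. \<Sum>k\<in>UNIV.
         complex_of_real (a k j x) * weak_deriv \<Omega> k u x * cnj (weak_deriv \<Omega> j v x)) \<partial>lebesgue_on \<Omega>)"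

definition form_operator ::
    "(real ^ 'd::finite) set \<Rightarrow> ('d \<Rightarrow> 'd \<Rightarrow> real ^ 'd \<Rightarrow> real) \<Rightarrow> (real ^ 'd) operator" where
  "form_operator \<Omega> a =
     {(u, g). u \<in> H1_0 \<Omega> \<and> g \<in> L2 (lebesgue_on \<Omega>) \<and>
        (\<forall>v\<in>H1_0 \<Omega>. elliptic_form \<Omega> a u v = L2_inner (lebesgue_on \<Omega>) g v)}"

text \<open>A choice of representatives \<open>u t\<close> of \<open>exp(itA) f\<close>, for all real \<open>t\<close>, such that for almost
  every \<open>x\<close> the function \<open>t \<mapsto> u t x\<close> is continuous.\<close>

definition continuous_representative ::
    "'a measure \<Rightarrow> 'a operator \<Rightarrow> ('a \<Rightarrow> complex) \<Rightarrow> (real \<Rightarrow> 'a \<Rightarrow> complex) \<Rightarrow> bool" where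
  "continuous_representative M A f u \<longleftrightarrow>
     (\<forall>t. (f, u t) \<in> unitary_group M A t) \<and> (AE x in M. continuous_on UNIV (\<lambda>t. u t x))"

end

theory Submission
  imports Defs
begin

text \<open>For the spectral resolution E that the assumption on f supplies, replace \<open>exp (itr)\<close> on
  \<open>[-2\<^sup>n, 2\<^sup>n)\<close> by its values at the grid points of mesh \<open>4\<^sup>-\<^sup>n\<close>, and by 0 elsewhere. This gives finite
  sums \<open>u\<^sub>n(t, x)\<close> of the functions \<open>E(cell) f\<close> with coefficients continuous in t. By the
  Cauchy-Schwarz inequality over the \<open>O(8\<^sup>n)\<close> cells, the L2 norm squared of
  \<open>sup\<^bsub>|t| \<le> T\<^esub> |u\<^sub>n\<^sub>+\<^sub>1(t, x) - u\<^sub>n(t, x)|\<close> is at most a multiple of \<open>8\<^sup>n\<close> times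
  \<open>T\<^sup>2 16\<^sup>-\<^sup>n (f, f) + (E(|r| \<ge> 2\<^sup>n) f, f)\<close>. The second term is \<open>O(16\<^sup>-\<^sup>n)\<close> since f lies in the domain of
  a power of A of exponent at least 2 and the spectrum of A is non-negative by ellipticity. Hence
  for almost every x the \<open>u\<^sub>n\<close> converge locally uniformly in t, and their limit is a continuous
  representative. For any continuous representative, the value at time 0 is f almost
  everywhere.\<close>

section \<open>L2\<close>

lemma borel_measurable_cnj [measurable (raw)]:
  "f \<in> borel_measurable M \<Longrightarrow> (\<lambda>x. cnj (f x)) \<in> borel_measurable M"
  by (rule borel_measurable_continuous_on) (auto intro: continuous_intros)

lemma L2_measurable: "f \<in> L2 M \<Longrightarrow> f \<in> borel_measurable M"
  and L2_integrable_sq: "f \<in> L2 M \<Longrightarrow> integrable M (\<lambda>x. (cmod (f x))\<^sup>2)"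
  by (auto simp: L2_def)

lemma L2_norm_sq: "(L2_norm M f)\<^sup>2 = (\<integral>x. (cmod (f x))\<^sup>2 \<partial>M)"
  unfolding L2_norm_def by (simp add: integral_nonneg_AE)

lemma cmod_add_sq_le: "(cmod (a + b))\<^sup>2 \<le> 2 * (cmod a)\<^sup>2 + 2 * (cmod b)\<^sup>2"
proof -
  have "(cmod (a + b))\<^sup>2 \<le> (cmod a + cmod b)\<^sup>2"
    by (intro power_mono norm_triangle_ineq) auto
  moreover have "2 * cmod a * cmod b \<le> (cmod a)\<^sup>2 + (cmod b)\<^sup>2"
    by (rule sum_squares_bound)
  ultimately show ?thesis by (simp add: power2_sum)
qed

lemma L2_add:
  assumes "f \<in> L2 M" "g \<in> L2 M"
  shows "(\<lambda>x. f x + g x) \<in> L2 M"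
proof -
  note [measurable] = assms[THEN L2_measurable]
  have "integrable M (\<lambda>x. (cmod (f x + g x))\<^sup>2)"
  proof (rule Bochner_Integration.integrable_bound)
    show "integrable M (\<lambda>x. 2 * (cmod (f x))\<^sup>2 + 2 * (cmod (g x))\<^sup>2)"
      using assms by (auto intro!: L2_integrable_sq)
    show "AE x in M. norm ((cmod (f x + g x))\<^sup>2) \<le> norm (2 * (cmod (f x))\<^sup>2 + 2 * (cmod (g x))\<^sup>2)"
      by (simp add: cmod_add_sq_le)
  qed measurable
  then show ?thesis by (simp add: L2_def)
qed

lemma L2_cmult: "f \<in> L2 M \<Longrightarrow> (\<lambda>x. c * f x) \<in> L2 M"
  by (auto simp: L2_def norm_mult power_mult_distrib)

lemma L2_diff:
  assumes "f \<in> L2 M" "g \<in> L2 M"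
  shows "(\<lambda>x. f x - g x) \<in> L2 M"
  using L2_add[OF assms(1) L2_cmult[OF assms(2), of "-1"]] by simp

lemma L2_zero: "(\<lambda>x. 0) \<in> L2 M"
  by (simp add: L2_def)

lemma L2_sum: "(\<And>i. i \<in> I \<Longrightarrow> f i \<in> L2 M) \<Longrightarrow> (\<lambda>x. \<Sum>i\<in>I. f i x) \<in> L2 M"
  by (induction I rule: infinite_finite_induct) (auto intro: L2_zero L2_add)

lemma L2_mult_integrable:
  assumes "f \<in> L2 M" "g \<in> L2 M"
  shows "integrable M (\<lambda>x. f x * cnj (g x))"
proof (rule Bochner_Integration.integrable_bound)
  show "integrable M (\<lambda>x. (cmod (f x))\<^sup>2 + (cmod (g x))\<^sup>2)"
    using assms by (auto intro!: L2_integrable_sq)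
  show "AE x in M. norm (f x * cnj (g x)) \<le> norm ((cmod (f x))\<^sup>2 + (cmod (g x))\<^sup>2)"
  proof (intro AE_I2)
    fix x
    have "0 \<le> cmod (f x) * cmod (g x)" by simp
    then show "norm (f x * cnj (g x)) \<le> norm ((cmod (f x))\<^sup>2 + (cmod (g x))\<^sup>2)"
      using sum_squares_bound[of "cmod (f x)" "cmod (g x)"]
      unfolding norm_mult complex_mod_cnj real_norm_def by linarith
  qed
  note [measurable] = assms[THEN L2_measurable]
  show "(\<lambda>x. f x * cnj (g x)) \<in> borel_measurable M"
    by measurable
qed

lemma L2_inner_add_left:
  "f \<in> L2 M \<Longrightarrow> g \<in> L2 M \<Longrightarrow> h \<in> L2 M \<Longrightarrow>
    L2_inner M (\<lambda>x. f x + g x) h = L2_inner M f h + L2_inner M g h"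
  unfolding L2_inner_def by (simp add: distrib_right L2_mult_integrable)

lemma L2_inner_diff_left:
  "f \<in> L2 M \<Longrightarrow> g \<in> L2 M \<Longrightarrow> h \<in> L2 M \<Longrightarrow>
    L2_inner M (\<lambda>x. f x - g x) h = L2_inner M f h - L2_inner M g h"
  unfolding L2_inner_def by (simp add: left_diff_distrib L2_mult_integrable)

lemma L2_inner_cmult_left: "L2_inner M (\<lambda>x. c * f x) h = c * L2_inner M f h"
  unfolding L2_inner_def by (simp add: mult.assoc)

lemma L2_inner_sum_left:
  assumes "\<And>i. i \<in> I \<Longrightarrow> f i \<in> L2 M" "h \<in> L2 M"
  shows "L2_inner M (\<lambda>x. \<Sum>i\<in>I. f i x) h = (\<Sum>i\<in>I. L2_inner M (f i) h)"
  using assms unfolding L2_inner_def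
  by (simp add: sum_distrib_right L2_mult_integrable Bochner_Integration.integral_sum)

lemma L2_inner_commute: "L2_inner M g f = cnj (L2_inner M f g)"
  unfolding L2_inner_def Bochner_Integration.integral_cnj[of M "\<lambda>x. f x * cnj (g x)", symmetric]
  by (simp add: mult.commute)

lemma L2_inner_cmult_right: "L2_inner M h (\<lambda>x. c * f x) = cnj c * L2_inner M h f"
  by (subst (1 2) L2_inner_commute) (simp add: L2_inner_cmult_left)

lemma L2_inner_sum_right:
  assumes "\<And>i. i \<in> I \<Longrightarrow> f i \<in> L2 M" "h \<in> L2 M"
  shows "L2_inner M h (\<lambda>x. \<Sum>i\<in>I. f i x) = (\<Sum>i\<in>I. L2_inner M h (f i))"
  by (subst (1 2) L2_inner_commute) (simp add: L2_inner_sum_left assms)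

lemma L2_inner_cong:
  assumes "L2_eq M f f'" "L2_eq M g g'"
    and "f \<in> L2 M" "f' \<in> L2 M" "g \<in> L2 M" "g' \<in> L2 M"
  shows "L2_inner M f g = L2_inner M f' g'"
  unfolding L2_inner_def
proof (rule integral_cong_AE)
  note [measurable] = assms(3-6)[THEN L2_measurable]
  show "(\<lambda>x. f x * cnj (g x)) \<in> borel_measurable M" "(\<lambda>x. f' x * cnj (g' x)) \<in> borel_measurable M"
    by measurable
  show "AE x in M. f x * cnj (g x) = f' x * cnj (g' x)"
    using assms(1,2) unfolding L2_eq_def by eventually_elim simp
qed

lemma L2_inner_self: "L2_inner M f f = complex_of_real ((L2_norm M f)\<^sup>2)"
  unfolding L2_inner_def L2_norm_sq
  by (simp only: complex_norm_square[symmetric] integral_complex_of_real)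

lemma L2_norm_nonneg: "0 \<le> L2_norm M f"
  unfolding L2_norm_def by (simp add: integral_nonneg_AE)

lemma L2_norm_cong_AE:
  assumes "L2_eq M f g" "f \<in> borel_measurable M" "g \<in> borel_measurable M"
  shows "L2_norm M f = L2_norm M g"
proof -
  note [measurable] = assms(2,3)
  have "(\<integral>x. (cmod (f x))\<^sup>2 \<partial>M) = (\<integral>x. (cmod (g x))\<^sup>2 \<partial>M)"
    by (rule integral_cong_AE) (use assms(1) in \<open>auto simp: L2_eq_def\<close>)
  then show ?thesis by (simp add: L2_norm_def)
qed

lemma L2_eq_zero:
  assumes "f \<in> L2 M" "L2_norm M f = 0"
  shows "L2_eq M f (\<lambda>x. 0)"
proof -
  have "(\<integral>x. (cmod (f x))\<^sup>2 \<partial>M) = 0"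
    using assms(2) L2_norm_sq[of M f] by simp
  then have "AE x in M. (cmod (f x))\<^sup>2 = 0"
    using integral_nonneg_eq_0_iff_AE[OF L2_integrable_sq[OF assms(1)]] by simp
  then show ?thesis by (simp add: L2_eq_def)
qed

text \<open>Testing against the difference of \<open>f\<close> and \<open>g\<close> shows that its
  norm vanishes. In this way a weak identity, such as the additivity of \<open>E\<close>, becomes an
  identity almost everywhere.\<close>

lemma L2_eqI_inner:
  assumes "f \<in> L2 M" "g \<in> L2 M"
    and "\<And>h. h \<in> L2 M \<Longrightarrow> L2_inner M f h = L2_inner M g h"
  shows "L2_eq M f g"
proof -
  let ?d = "\<lambda>x. f x - g x"
  have d: "?d \<in> L2 M" using assms by (intro L2_diff)
  have "L2_inner M ?d ?d = 0"
    using assms d by (simp add: L2_inner_diff_left)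
  then have "L2_eq M ?d (\<lambda>x. 0)"
    using d by (intro L2_eq_zero) (simp_all add: L2_inner_self)
  then show ?thesis by (auto simp: L2_eq_def)
qed

lemma L2_norm_add_sq_le:
  assumes "f \<in> L2 M" "g \<in> L2 M"
  shows "(L2_norm M (\<lambda>x. f x + g x))\<^sup>2 \<le> 2 * (L2_norm M f)\<^sup>2 + 2 * (L2_norm M g)\<^sup>2"
proof -
  have "(\<integral>x. (cmod (f x + g x))\<^sup>2 \<partial>M) \<le> (\<integral>x. 2 * (cmod (f x))\<^sup>2 + 2 * (cmod (g x))\<^sup>2 \<partial>M)"
    using assms L2_add[OF assms] by (intro integral_mono) (auto intro!: L2_integrable_sq cmod_add_sq_le)
  also have "\<dots> = 2 * (\<integral>x. (cmod (f x))\<^sup>2 \<partial>M) + 2 * (\<integral>x. (cmod (g x))\<^sup>2 \<partial>M)"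
    using assms by (simp add: L2_integrable_sq)
  finally show ?thesis by (simp add: L2_norm_sq)
qed

text \<open>The inequality for nonnegative extended-real integrals gives this once the modulus has
  been moved inside the integral.\<close>

lemma L2_Cauchy_Schwarz:
  assumes "f \<in> L2 M" "g \<in> L2 M"
  shows "cmod (L2_inner M f g) \<le> L2_norm M f * L2_norm M g"
proof -
  note [measurable] = assms[THEN L2_measurable]
  have sq: "(\<integral>\<^sup>+x. (ennreal (cmod (h x)))\<^sup>2 \<partial>M) = ennreal ((L2_norm M h)\<^sup>2)" if "h \<in> L2 M" for h
    using nn_integral_eq_integral[OF L2_integrable_sq[OF that]]
    by (simp add: L2_norm_sq ennreal_power)
  have "ennreal (cmod (L2_inner M f g)) \<le> (\<integral>\<^sup>+x. ennreal (cmod (f x)) * ennreal (cmod (g x)) \<partial>M)"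
    unfolding L2_inner_def using integral_norm_bound_ennreal[OF L2_mult_integrable[OF assms]]
    by (simp add: norm_mult ennreal_mult)
  then have "(ennreal (cmod (L2_inner M f g)))\<^sup>2
      \<le> (\<integral>\<^sup>+x. ennreal (cmod (f x)) * ennreal (cmod (g x)) \<partial>M)\<^sup>2"
    by (intro power_mono) auto
  also have "\<dots> \<le> ennreal ((L2_norm M f)\<^sup>2) * ennreal ((L2_norm M g)\<^sup>2)"
    unfolding sq[OF assms(1), symmetric] sq[OF assms(2), symmetric]
    by (rule Cauchy_Schwarz_nn_integral) measurable
  finally have "(cmod (L2_inner M f g))\<^sup>2 \<le> (L2_norm M f * L2_norm M g)\<^sup>2"
    by (simp add: ennreal_power power_mult_distrib flip: ennreal_mult)
  then show ?thesis
    by (rule power2_le_imp_le) (simp add: L2_norm_nonneg)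
qed

text \<open>Division by \<open>p ^ n\<close> leaves integrals dominated by a geometric series of
  ratio \<open>q / p < 1\<close>, so the weighted series has finite integral and is finite almost
  everywhere. When \<open>q < p < 1\<close>, this retains some decay in n at almost every
  point.\<close>

lemma AE_summable_of_geometric_integrals:
  fixes H :: "nat \<Rightarrow> 'a \<Rightarrow> real"
  assumes int: "\<And>n. integrable M (H n)" and nonneg: "\<And>n x. 0 \<le> H n x"
    and bound: "\<And>n. (\<integral>x. H n x \<partial>M) \<le> C * q ^ n" and q: "0 < q" "q < p"
  shows "integrable M (\<lambda>x. \<Sum>n. H n x / p ^ n)" and "AE x in M. summable (\<lambda>n. H n x / p ^ n)"
proof -
  have p: "0 < p" using q by simp
  have [measurable]: "H n \<in> borel_measurable M" for n
    using int by auto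
  have C: "0 \<le> C"
  proof -
    have "0 \<le> (\<integral>x. H 0 x \<partial>M)" using nonneg by simp
    also have "\<dots> \<le> C" using bound[of 0] by simp
    finally show ?thesis .
  qed
  have sm: "summable (\<lambda>n. C * (q / p) ^ n)"
    using q p by (intro summable_mult summable_geometric) auto
  have i: "(\<integral>x. H n x / p ^ n \<partial>M) \<le> C * (q / p) ^ n" for n
    using bound[of n] p by (simp add: power_divide divide_right_mono)
  have i0: "0 \<le> (\<integral>x. H n x / p ^ n \<partial>M)" for n
    using nonneg p by (intro integral_nonneg_AE) auto
  have "(\<integral>\<^sup>+x. (\<Sum>n. ennreal (H n x / p ^ n)) \<partial>M) = (\<Sum>n. \<integral>\<^sup>+x. ennreal (H n x / p ^ n) \<partial>M)"
    by (rule nn_integral_suminf) measurable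
  also have "\<dots> = (\<Sum>n. ennreal (\<integral>x. H n x / p ^ n \<partial>M))"
    using int nonneg p by (intro suminf_cong nn_integral_eq_integral) auto
  also have "\<dots> \<le> (\<Sum>n. ennreal (C * (q / p) ^ n))"
    by (intro suminf_le ennreal_leI i) auto
  also have "\<dots> = ennreal (\<Sum>n. C * (q / p) ^ n)"
    using sm C p q by (intro suminf_ennreal2) auto
  also have "\<dots> < \<infinity>" by simp
  finally have "AE x in M. (\<Sum>n. ennreal (H n x / p ^ n)) \<noteq> \<infinity>"
    by (intro nn_integral_noteq_infinite) auto
  then show ae: "AE x in M. summable (\<lambda>n. H n x / p ^ n)"
    by eventually_elim (use nonneg p in \<open>auto intro!: summable_suminf_not_top\<close>)
  show "integrable M (\<lambda>x. \<Sum>n. H n x / p ^ n)"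
  proof (rule integrable_suminf)
    show "AE x in M. summable (\<lambda>n. norm (H n x / p ^ n))"
      using ae by eventually_elim (use nonneg p in auto)
    have *: "(\<lambda>n. \<integral>x. norm (H n x / p ^ n) \<partial>M) = (\<lambda>n. \<integral>x. H n x / p ^ n \<partial>M)"
      using nonneg p by auto
    show "summable (\<lambda>n. \<integral>x. norm (H n x / p ^ n) \<partial>M)"
      unfolding * by (rule summable_comparison_test'[OF sm, of 0]) (use i i0 in \<open>simp only: real_norm_def abs_of_nonneg\<close>)
  qed (use int in simp)
qed

text \<open>\<open>sqrt (h n)\<close> is the geometric mean of \<open>h n / p ^ n\<close> and
  \<open>p ^ n\<close>, hence at most their arithmetic mean, and both sequences are
  summable.\<close>

lemma sqrt_summable_of_weighted:
  assumes "summable (\<lambda>n. h n / p ^ n)" "\<And>n. 0 \<le> h n" "0 < p" "p < 1"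
  shows "summable (\<lambda>n. sqrt (h n))"
proof (rule summable_comparison_test')
  show "summable (\<lambda>n. (h n / p ^ n + p ^ n) / 2)"
    using assms by (intro summable_divide summable_add summable_geometric) auto
  fix n :: nat
  have "sqrt ((h n / p ^ n) * p ^ n) \<le> (h n / p ^ n + p ^ n) / 2"
    using assms by (intro arith_geo_mean_sqrt) auto
  then show "norm (sqrt (h n)) \<le> (h n / p ^ n + p ^ n) / 2"
    using assms by simp
qed

text \<open>By the Cauchy-Schwarz inequality, the weighted square function
  \<open>\<Sum>k. |g\<^sub>k\<^sub>+\<^sub>1 - g\<^sub>k|\<^sup>2 / p\<^sup>k\<close> with \<open>q < p < 1\<close> dominates every \<open>|g\<^sub>m - g\<^sub>n|\<^sup>2\<close> up to a constant.\<close>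

lemma L2_geometric_Cauchy:
  assumes L2: "\<And>n. g n \<in> L2 M"
    and bound: "\<And>n. (L2_norm M (\<lambda>x. g (Suc n) x - g n x))\<^sup>2 \<le> C * q ^ n" and q: "0 < q" "q < 1"
  shows "AE x in M. (\<lambda>n. g n x) \<longlonglongrightarrow> lim (\<lambda>n. g n x)"
    and "(\<lambda>x. lim (\<lambda>n. g n x)) \<in> L2 M"
    and "(\<lambda>n. L2_norm M (\<lambda>x. lim (\<lambda>n. g n x) - g n x)) \<longlonglongrightarrow> 0"
proof -
  obtain p where p: "q < p" "p < 1" using q dense by blast
  then have p0: "0 < p" using q by simp
  define G where "G = (\<lambda>x. lim (\<lambda>n. g n x))"
  define H where "H = (\<lambda>n x. (cmod (g (Suc n) x - g n x))\<^sup>2)"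
  \<comment> \<open>The factor \<open>1 / (1 - p)\<close> is the sum of all \<open>p ^ k\<close>,
    the second factor in the Cauchy-Schwarz bound below.\<close>
  define w where "w = (\<lambda>x. (1 / (1 - p)) * (\<Sum>n. H n x / p ^ n))"
  have [measurable]: "g n \<in> borel_measurable M" for n
    using L2 by (rule L2_measurable)
  have G_meas[measurable]: "G \<in> borel_measurable M"
    unfolding G_def by measurable
  have H: "\<And>n. integrable M (H n)" "\<And>n x. 0 \<le> H n x" "\<And>n. (\<integral>x. H n x \<partial>M) \<le> C * q ^ n"
    using bound by (auto simp: H_def L2_norm_sq intro!: L2_integrable_sq L2_diff L2)
  note W = AE_summable_of_geometric_integrals[OF H q(1) p(1)]
  have w_int: "integrable M w"
    unfolding w_def by (intro integrable_mult_right W)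
  \<comment> \<open>The bound depends on neither n nor m, so it survives the limit in m and then
    dominates the errors of the limit function.\<close>
  have dom: "(cmod (g m x - g n x))\<^sup>2 \<le> w x" if "summable (\<lambda>n. H n x / p ^ n)" "n \<le> m" for n m x
  proof -
    have "cmod (g m x - g n x) = cmod (\<Sum>k\<in>{n..<m}. g (Suc k) x - g k x)"
      using sum_Suc_diff'[OF that(2), of "\<lambda>k. g k x"] by simp
    also have "\<dots> \<le> (\<Sum>k\<in>{n..<m}. cmod (g (Suc k) x - g k x))"
      by (rule norm_sum)
    also have "\<dots> = (\<Sum>k\<in>{n..<m}. sqrt (p ^ k) * sqrt (H k x / p ^ k))"
      using p0 by (simp add: H_def flip: real_sqrt_mult)
    finally have "(cmod (g m x - g n x))\<^sup>2 \<le> (\<Sum>k\<in>{n..<m}. sqrt (p ^ k) * sqrt (H k x / p ^ k))\<^sup>2"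
      by (intro power_mono) auto
    also have "\<dots> \<le> (\<Sum>k\<in>{n..<m}. (sqrt (p ^ k))\<^sup>2) * (\<Sum>k\<in>{n..<m}. (sqrt (H k x / p ^ k))\<^sup>2)"
      by (rule Cauchy_Schwarz_ineq_sum)
    also have "\<dots> = (\<Sum>k\<in>{n..<m}. p ^ k) * (\<Sum>k\<in>{n..<m}. H k x / p ^ k)"
      using p0 H(2) by simp
    also have "\<dots> \<le> (\<Sum>k. p ^ k) * (\<Sum>k. H k x / p ^ k)"
    proof (intro mult_mono sum_le_suminf sum_nonneg suminf_nonneg)
      show "summable (\<lambda>k. p ^ k)" "summable (\<lambda>k. p ^ k)" using p p0 by (auto intro!: summable_geometric)
    qed (use that p0 H(2) in auto)
    also have "\<dots> = w x"
      using p p0 by (simp add: w_def suminf_geometric)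
    finally show ?thesis .
  qed
  show conv: "AE x in M. (\<lambda>n. g n x) \<longlonglongrightarrow> lim (\<lambda>n. g n x)"
    using W(2)
  proof eventually_elim
    case (elim x)
    have "summable (\<lambda>n. sqrt (H n x))"
      using sqrt_summable_of_weighted[OF elim] H(2) p p0 by blast
    then have "summable (\<lambda>n. g (Suc n) x - g n x)"
      by (simp add: H_def summable_norm_cancel)
    then have "convergent (\<lambda>n. \<Sum>k<n. g (Suc k) x - g k x)"
      by (simp add: summable_iff_convergent)
    then have "convergent (\<lambda>n. g n x - g 0 x)"
      unfolding sum_lessThan_telescope[of "\<lambda>k. g k x"] .
    then have "convergent (\<lambda>n. g n x)"
      by (simp only: convergent_diff_const_right_iff)
    then show ?case by (simp add: convergent_LIMSEQ_iff)
  qed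
  have lim_dom: "AE x in M. (\<lambda>n. g n x) \<longlonglongrightarrow> G x \<and> (\<forall>n. (cmod (G x - g n x))\<^sup>2 \<le> w x)"
    using conv W(2)
  proof eventually_elim
    case (elim x)
    have lim: "(\<lambda>n. g n x) \<longlonglongrightarrow> G x" using elim by (simp add: G_def)
    have "(cmod (G x - g n x))\<^sup>2 \<le> w x" for n
    proof (rule LIMSEQ_le_const2)
      show "(\<lambda>m. (cmod (g m x - g n x))\<^sup>2) \<longlonglongrightarrow> (cmod (G x - g n x))\<^sup>2"
        by (intro tendsto_intros lim)
      show "\<exists>N. \<forall>m\<ge>N. (cmod (g m x - g n x))\<^sup>2 \<le> w x"
        using dom[OF elim(2)] by blast
    qed
    then show ?case using lim by simp
  qed
  have diff: "(\<lambda>x. G x - g n x) \<in> L2 M" for n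
  proof -
    have "integrable M (\<lambda>x. (cmod (G x - g n x))\<^sup>2)"
    proof (rule Bochner_Integration.integrable_bound[OF w_int])
      show "AE x in M. norm ((cmod (G x - g n x))\<^sup>2) \<le> norm (w x)"
        using lim_dom by eventually_elim (auto intro: order_trans)
    qed measurable
    then show ?thesis by (simp add: L2_def)
  qed
  show "(\<lambda>x. lim (\<lambda>n. g n x)) \<in> L2 M"
    using L2_add[OF diff[of 0] L2[of 0]] by (simp add: G_def)
  have "(\<lambda>n. \<integral>x. (cmod (G x - g n x))\<^sup>2 \<partial>M) \<longlonglongrightarrow> (\<integral>x. 0 \<partial>M)"
  proof (rule integral_dominated_convergence[OF _ _ w_int])
    show "AE x in M. (\<lambda>n. (cmod (G x - g n x))\<^sup>2) \<longlonglongrightarrow> 0"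
      using lim_dom
    proof eventually_elim
      case (elim x)
      then have "(\<lambda>n. (cmod (G x - g n x))\<^sup>2) \<longlonglongrightarrow> (cmod (G x - G x))\<^sup>2"
        by (intro tendsto_intros) auto
      then show ?case by simp
    qed
    show "AE x in M. norm ((cmod (G x - g n x))\<^sup>2) \<le> w x" for n
      using lim_dom by eventually_elim auto
  qed measurable
  then have "(\<lambda>n. sqrt (\<integral>x. (cmod (G x - g n x))\<^sup>2 \<partial>M)) \<longlonglongrightarrow> sqrt 0"
    by (intro tendsto_intros) simp
  then show "(\<lambda>n. L2_norm M (\<lambda>x. lim (\<lambda>n. g n x) - g n x)) \<longlonglongrightarrow> 0"
    by (simp add: L2_norm_def G_def)
qed

lemma L2_eq_refl: "L2_eq M f f"
  and L2_eq_sym: "L2_eq M f g \<Longrightarrow> L2_eq M g f"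
  by (auto simp: L2_eq_def)

lemma L2_eq_trans: "L2_eq M f g \<Longrightarrow> L2_eq M g h \<Longrightarrow> L2_eq M f h"
  unfolding L2_eq_def by (rule AE_mp) auto

lemma L2_eq_sum:
  assumes "finite I" "\<And>i. i \<in> I \<Longrightarrow> L2_eq M (f i) (g i)"
  shows "L2_eq M (\<lambda>x. \<Sum>i\<in>I. f i x) (\<lambda>x. \<Sum>i\<in>I. g i x)"
proof -
  have "AE x in M. \<forall>i\<in>I. f i x = g i x"
    using assms by (simp add: AE_finite_all L2_eq_def)
  then show ?thesis unfolding L2_eq_def by eventually_elim simp
qed

lemma L2_eq_cmult: "L2_eq M f g \<Longrightarrow> L2_eq M (\<lambda>x. c * f x) (\<lambda>x. c * g x)"
  unfolding L2_eq_def by (rule AE_mp) auto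

section \<open>Integration with respect to a projection-valued measure\<close>

locale spectral_measure =
  fixes M :: "'a measure" and E :: "real set \<Rightarrow> ('a \<Rightarrow> complex) \<Rightarrow> ('a \<Rightarrow> complex)"
  assumes pvm: "projection_valued_measure M E"
begin

lemma proj: "B \<in> sets borel \<Longrightarrow> orthogonal_projection M (E B)"
  using pvm by (simp add: projection_valued_measure_def)

lemma E_L2: "B \<in> sets borel \<Longrightarrow> f \<in> L2 M \<Longrightarrow> E B f \<in> L2 M"
  using proj[of B] by (simp add: orthogonal_projection_def)

lemma E_inner: "B \<in> sets borel \<Longrightarrow> f \<in> L2 M \<Longrightarrow> g \<in> L2 M \<Longrightarrow> L2_inner M (E B f) g = L2_inner M f (E B g)"
  using proj[of B] by (simp add: orthogonal_projection_def)

lemma E_UNIV: "f \<in> L2 M \<Longrightarrow> L2_eq M (E UNIV f) f"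
  using pvm by (simp add: projection_valued_measure_def)

lemma E_Int:
  "B \<in> sets borel \<Longrightarrow> C \<in> sets borel \<Longrightarrow> f \<in> L2 M \<Longrightarrow> L2_eq M (E (B \<inter> C) f) (E B (E C f))"
  using pvm by (simp add: projection_valued_measure_def)

lemma E_sums:
  "range B \<subseteq> sets borel \<Longrightarrow> disjoint_family B \<Longrightarrow> f \<in> L2 M \<Longrightarrow> g \<in> L2 M \<Longrightarrow>
    (\<lambda>n::nat. L2_inner M (E (B n) f) g) sums L2_inner M (E (\<Union>n. B n) f) g"
  using pvm unfolding projection_valued_measure_def by blast

text \<open>Self-adjointness moves \<open>E C\<close> to the other side and multiplicativity merges
  the two projections. For disjoint sets this is the orthogonality behind the Pythagorean
  identity.\<close>

lemma E_inner_E: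
  assumes "B \<in> sets borel" "C \<in> sets borel" "f \<in> L2 M" "g \<in> L2 M"
  shows "L2_inner M (E B f) (E C g) = L2_inner M (E (C \<inter> B) f) g"
proof -
  have "L2_inner M (E B f) (E C g) = L2_inner M (E C (E B f)) g"
    using assms by (simp add: E_inner E_L2)
  also have "\<dots> = L2_inner M (E (C \<inter> B) f) g"
    using assms by (intro L2_inner_cong E_L2 L2_eq_sym[OF E_Int] L2_eq_refl) auto
  finally show ?thesis .
qed

lemma E_inner_self:
  assumes "B \<in> sets borel" "f \<in> L2 M"
  shows "L2_inner M (E B f) f = complex_of_real ((L2_norm M (E B f))\<^sup>2)"
  using E_inner_E[OF assms(1,1,2,2)] by (simp add: L2_inner_self)

text \<open>The constant sequence of empty sets is a disjoint family. Its series of inner products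
  converges and has constant terms, so these vanish.\<close>

lemma E_empty:
  assumes "f \<in> L2 M"
  shows "L2_eq M (E {} f) (\<lambda>x. 0)"
proof (rule L2_eqI_inner)
  fix h assume h: "h \<in> L2 M"
  have "(\<lambda>n::nat. L2_inner M (E {} f) h) sums L2_inner M (E (\<Union>n::nat. {}) f) h"
    using assms h by (intro E_sums) (auto simp: disjoint_family_on_def)
  then have "L2_inner M (E {} f) h = 0"
    using LIMSEQ_unique[OF summable_LIMSEQ_zero[OF sums_summable] tendsto_const] by metis
  then show "L2_inner M (E {} f) h = L2_inner M (\<lambda>x. 0) h"
    by (simp add: L2_inner_def)
qed (use assms E_L2 L2_zero in auto)

lemma E_Un:
  assumes "B \<in> sets borel" "C \<in> sets borel" "B \<inter> C = {}" "f \<in> L2 M"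
  shows "L2_eq M (E (B \<union> C) f) (\<lambda>x. E B f x + E C f x)"
proof (rule L2_eqI_inner)
  fix h assume h: "h \<in> L2 M"
  \<comment> \<open>Countable additivity is applied to \<open>B\<close>, \<open>C\<close> and then
    empty sets, so only the terms 0 and 1 contribute.\<close>
  let ?A = "binaryset B C"
  have "(\<lambda>n. L2_inner M (E (?A n) f) h) sums L2_inner M (E (\<Union>n. ?A n) f) h"
    using assms h by (intro E_sums) (auto simp: disjoint_family_on_def binaryset_def)
  moreover have "(\<lambda>n. L2_inner M (E (?A n) f) h) sums (\<Sum>n\<in>{0, 1}. L2_inner M (E (?A n) f) h)"
  proof (rule sums_finite)
    fix n :: nat assume "n \<notin> {0, 1}"
    then have "?A n = {}" by (simp add: binaryset_def)
    then have "L2_inner M (E (?A n) f) h = L2_inner M (\<lambda>x. 0) h"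
      using assms h by (simp add: L2_inner_cong[OF E_empty L2_eq_refl] E_L2 L2_zero)
    then show "L2_inner M (E (?A n) f) h = 0"
      by (simp add: L2_inner_def)
  qed simp
  ultimately have "L2_inner M (E (B \<union> C) f) h = L2_inner M (E B f) h + L2_inner M (E C f) h"
    by (auto simp: UN_binaryset_eq binaryset_def dest: sums_unique2)
  then show "L2_inner M (E (B \<union> C) f) h = L2_inner M (\<lambda>x. E B f x + E C f x) h"
    using assms h by (simp add: L2_inner_add_left E_L2)
qed (use assms in \<open>auto intro!: L2_add E_L2\<close>)

lemma E_UN:
  assumes "finite I" "\<And>i. i \<in> I \<Longrightarrow> B i \<in> sets borel" "disjoint_family_on B I" "f \<in> L2 M"
  shows "L2_eq M (E (\<Union>i\<in>I. B i) f) (\<lambda>x. \<Sum>i\<in>I. E (B i) f x)"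
  using assms(1-3)
proof (induction I)
  case empty
  then show ?case using E_empty assms by simp
next
  case (insert i I)
  have "L2_eq M (E (B i \<union> (\<Union>i\<in>I. B i)) f) (\<lambda>x. E (B i) f x + E (\<Union>i\<in>I. B i) f x)"
  proof (rule E_Un)
    show "B i \<inter> (\<Union>i\<in>I. B i) = {}"
      using insert.hyps(2) insert.prems(2) by (auto simp: disjoint_family_on_def)
  qed (use insert assms in auto)
  moreover have "L2_eq M (E (\<Union>i\<in>I. B i) f) (\<lambda>x. \<Sum>i\<in>I. E (B i) f x)"
    using insert by (auto simp: disjoint_family_on_def)
  ultimately have "AE x in M. E (B i \<union> (\<Union>i\<in>I. B i)) f x = E (B i) f x + (\<Sum>i\<in>I. E (B i) f x)"
    unfolding L2_eq_def by eventually_elim simp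
  then show ?case
    using insert.hyps by (simp add: L2_eq_def)
qed

section \<open>The scalar spectral measures\<close>

abbreviation \<mu> :: "('a \<Rightarrow> complex) \<Rightarrow> real measure" where
  "\<mu> f \<equiv> scalar_spectral_measure M E f"

lemma space_\<mu>[simp]: "space (\<mu> f) = UNIV"
  and sets_\<mu>[simp, measurable_cong]: "sets (\<mu> f) = sets borel"
  unfolding scalar_spectral_measure_def
  using sets.sigma_sets_eq[of "borel :: real measure"] by (auto simp: space_measure_of_conv sets_measure_of)

text \<open>\<open>measure_of\<close> yields the intended values once the set function is shown to
  be a measure. Nonnegativity holds because \<open>(E B f, f)\<close> is the squared norm of
  \<open>E B f\<close>; countable additivity is the weak additivity of \<open>E\<close>.\<close>

lemma emeasure_\<mu>:
  assumes "B \<in> sets borel" "f \<in> L2 M"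
  shows "emeasure (\<mu> f) B = ennreal ((L2_norm M (E B f))\<^sup>2)"
proof -
  have eq: "Re (L2_inner M (E B f) f) = (L2_norm M (E B f))\<^sup>2" if "B \<in> sets borel" for B
    using E_inner_self[OF that assms(2)] by simp
  have "emeasure (\<mu> f) B = ennreal (Re (L2_inner M (E B f) f))"
  proof (rule emeasure_measure_of[OF scalar_spectral_measure_def])
    show "positive (sets (\<mu> f)) (\<lambda>B. ennreal (Re (L2_inner M (E B f) f)))"
      using L2_inner_cong[OF E_empty L2_eq_refl E_L2 L2_zero assms(2,2)] assms(2)
      by (simp add: positive_def L2_inner_def)
    show "countably_additive (sets (\<mu> f)) (\<lambda>B. ennreal (Re (L2_inner M (E B f) f)))"
    proof (rule countably_additiveI)
      fix A :: "nat \<Rightarrow> real set"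
      assume A: "range A \<subseteq> sets (\<mu> f)" "disjoint_family A"
      then have "(\<lambda>n. Re (L2_inner M (E (A n) f) f)) sums Re (L2_inner M (E (\<Union>n. A n) f) f)"
        using assms by (intro sums_Re E_sums) auto
      then show "(\<Sum>i. ennreal (Re (L2_inner M (E (A i) f) f))) = ennreal (Re (L2_inner M (E (\<Union>i. A i) f) f))"
        using A by (intro suminf_ennreal_eq) (auto simp: eq)
    qed
  qed (use assms in auto)
  then show ?thesis using eq assms by simp
qed

lemma measure_\<mu>: "B \<in> sets borel \<Longrightarrow> f \<in> L2 M \<Longrightarrow> measure (\<mu> f) B = (L2_norm M (E B f))\<^sup>2"
  by (simp add: measure_def emeasure_\<mu>)

lemma finite_measure_\<mu>: "f \<in> L2 M \<Longrightarrow> finite_measure (\<mu> f)"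
  by (rule finite_measureI) (simp add: emeasure_\<mu>)

section \<open>Spectral integrals of simple functions and their isometry\<close>

lemma simple_level_set: "simple_function borel s \<Longrightarrow> s -` {c} \<in> sets borel"
  for s :: "real \<Rightarrow> complex"
  using simple_functionD(2)[of borel s "{c}"] by simp

lemma simple_L2:
  assumes "simple_function borel s" "f \<in> L2 M"
  shows "simple_spectral_integral E s f \<in> L2 M"
  unfolding simple_spectral_integral_def
  using assms by (intro L2_sum L2_cmult E_L2 simple_level_set)

text \<open>The integral is defined through the level sets of \<open>s\<close>; this allows any
  finite family of sets of constancy in their place. Both sums are compared through the
  intersections of the level sets with the \<open>B i\<close>, exchanging the order of
  summation.\<close>

lemma simple_partition:
  assumes s: "simple_function borel s" and f: "f \<in> L2 M"
    and I: "finite I" "\<And>i. i \<in> I \<Longrightarrow> B i \<in> sets borel" "disjoint_family_on B I"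
    and val: "\<And>i r. i \<in> I \<Longrightarrow> r \<in> B i \<Longrightarrow> s r = c i"
    and zero: "\<And>r. r \<notin> (\<Union>i\<in>I. B i) \<Longrightarrow> s r = 0"
  shows "L2_eq M (simple_spectral_integral E s f) (\<lambda>x. \<Sum>i\<in>I. c i * E (B i) f x)"
proof -
  have R: "finite (range s)" using simple_functionD(1)[OF s] by simp
  have "L2_eq M (simple_spectral_integral E s f) (\<lambda>x. \<Sum>d\<in>range s. \<Sum>i\<in>I. d * E (s -` {d} \<inter> B i) f x)"
    unfolding simple_spectral_integral_def
  proof (rule L2_eq_sum[OF R])
    fix d
    show "L2_eq M (\<lambda>x. d * E (s -` {d}) f x) (\<lambda>x. \<Sum>i\<in>I. d * E (s -` {d} \<inter> B i) f x)"
    \<comment> \<open>The level set of 0 may reach outside the union of the \<open>B i\<close>, but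
      it enters with coefficient 0.\<close>
    proof (cases "d = 0")
      case False
      have *: "s -` {d} = (\<Union>i\<in>I. s -` {d} \<inter> B i)"
        using zero False by auto
      have "L2_eq M (E (\<Union>i\<in>I. s -` {d} \<inter> B i) f) (\<lambda>x. \<Sum>i\<in>I. E (s -` {d} \<inter> B i) f x)"
      proof (rule E_UN)
        show "disjoint_family_on (\<lambda>i. s -` {d} \<inter> B i) I"
          using I(3) unfolding disjoint_family_on_def by blast
      qed (use I f simple_level_set[OF s] in auto)
      from L2_eq_cmult[OF this, of d] show ?thesis
        unfolding *[symmetric] sum_distrib_left .
    qed (simp add: L2_eq_refl)
  qed
  also have "(\<lambda>x. \<Sum>d\<in>range s. \<Sum>i\<in>I. d * E (s -` {d} \<inter> B i) f x)
      = (\<lambda>x. \<Sum>i\<in>I. \<Sum>d\<in>range s. d * E (s -` {d} \<inter> B i) f x)"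
    by (intro ext sum.swap)
  finally have 1: "L2_eq M (simple_spectral_integral E s f) \<dots>" .
  have 2: "L2_eq M (\<lambda>x. \<Sum>i\<in>I. \<Sum>d\<in>range s. d * E (s -` {d} \<inter> B i) f x) (\<lambda>x. \<Sum>i\<in>I. c i * E (B i) f x)"
  proof (rule L2_eq_sum[OF I(1)])
    fix i assume i: "i \<in> I"
    have ae: "AE x in M. E {} f x = 0"
      using E_empty[OF f] by (simp add: L2_eq_def)
    show "L2_eq M (\<lambda>x. \<Sum>d\<in>range s. d * E (s -` {d} \<inter> B i) f x) (\<lambda>x. c i * E (B i) f x)"
    \<comment> \<open>For an empty \<open>B i\<close> the value \<open>c i\<close> is arbitrary and
      may lie outside \<open>range s\<close>; both sides then vanish with
      \<open>E {} f\<close>.\<close>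
    proof (cases "B i = {}")
      case True
      show ?thesis
        unfolding L2_eq_def True using ae by eventually_elim simp
    next
      case False
      then obtain r where r: "r \<in> B i" by blast
      have ci: "c i \<in> range s"
        using val[OF i r] by (metis rangeI)
      have *: "s -` {d} \<inter> B i = (if d = c i then B i else {})" for d
        using val[OF i] by auto
      show ?thesis
        unfolding L2_eq_def using ae
      proof eventually_elim
        case (elim x)
        have "(\<Sum>d\<in>range s. d * E (s -` {d} \<inter> B i) f x) = (\<Sum>d\<in>range s. if d = c i then c i * E (B i) f x else 0)"
          using elim by (intro sum.cong) (auto simp: *)
        then show ?case using ci R by simp
      qed
    qed
  qed
  show ?thesis using L2_eq_trans[OF 1 2] .
qed

text \<open>The level sets of the pair \<open>(s, s')\<close> form one partition on which both
  functions and their difference are constant.\<close>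

lemma simple_diff:
  assumes s: "simple_function borel s" "simple_function borel s'" and f: "f \<in> L2 M"
  shows "L2_eq M (simple_spectral_integral E (\<lambda>r. s r - s' r) f)
    (\<lambda>x. simple_spectral_integral E s f x - simple_spectral_integral E s' f x)"
proof -
  define p where "p = (\<lambda>r. (s r, s' r))"
  have fin: "finite (range p)"
    using simple_functionD(1)[OF simple_function_Pair[OF s]] by (simp add: p_def)
  have B: "p -` {i} \<in> sets borel" for i
    using simple_functionD(2)[OF simple_function_Pair[OF s], of "{i}"] by (simp add: p_def)
  have dis: "disjoint_family_on (\<lambda>i. p -` {i}) (range p)"
    by (auto simp: disjoint_family_on_def)
  have 1: "L2_eq M (simple_spectral_integral E (\<lambda>r. s r - s' r) f)
      (\<lambda>x. \<Sum>i\<in>range p. (fst i - snd i) * E (p -` {i}) f x)"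
    by (rule simple_partition[OF simple_function_diff[OF s] f fin B dis]) (auto simp: p_def)
  have 2: "L2_eq M (simple_spectral_integral E s f) (\<lambda>x. \<Sum>i\<in>range p. fst i * E (p -` {i}) f x)"
    by (rule simple_partition[OF s(1) f fin B dis]) (auto simp: p_def)
  have 3: "L2_eq M (simple_spectral_integral E s' f) (\<lambda>x. \<Sum>i\<in>range p. snd i * E (p -` {i}) f x)"
    by (rule simple_partition[OF s(2) f fin B dis]) (auto simp: p_def)
  show ?thesis
    using 1 2 3 unfolding L2_eq_def
    by eventually_elim (simp add: left_diff_distrib sum_subtractf)
qed

text \<open>The Pythagorean identity: by \<open>E_inner_E\<close> only the diagonal terms of the
  double sum survive.\<close>

lemma L2_norm_disjoint_sum:
  assumes "finite I" "\<And>i. i \<in> I \<Longrightarrow> B i \<in> sets borel" "disjoint_family_on B I" "f \<in> L2 M"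
  shows "(L2_norm M (\<lambda>x. \<Sum>i\<in>I. c i * E (B i) f x))\<^sup>2 = (\<Sum>i\<in>I. (cmod (c i))\<^sup>2 * measure (\<mu> f) (B i))"
proof -
  have L: "(\<lambda>x. c i * E (B i) f x) \<in> L2 M" if "i \<in> I" for i
    using that assms by (intro L2_cmult E_L2)
  have in0: "L2_inner M (E {} f) f = 0"
    using L2_inner_cong[OF E_empty L2_eq_refl E_L2 L2_zero assms(4,4)] assms(4) by (simp add: L2_inner_def)
  have orth: "L2_inner M (E (B i) f) (E (B j) f) = (if j = i then of_real (measure (\<mu> f) (B i)) else 0)"
    if "i \<in> I" "j \<in> I" for i j
    using that assms in0 by (auto simp: E_inner_E measure_\<mu> E_inner_self disjoint_family_on_def Int_commute)
  have "complex_of_real ((L2_norm M (\<lambda>x. \<Sum>i\<in>I. c i * E (B i) f x))\<^sup>2)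
      = (\<Sum>i\<in>I. L2_inner M (\<lambda>x. c i * E (B i) f x) (\<lambda>x. \<Sum>i\<in>I. c i * E (B i) f x))"
    unfolding L2_inner_self[symmetric] using L L2_sum[OF L] by (rule L2_inner_sum_left)
  also have "\<dots> = (\<Sum>i\<in>I. \<Sum>j\<in>I. c i * cnj (c j) * L2_inner M (E (B i) f) (E (B j) f))"
  proof (rule sum.cong[OF refl])
    fix i assume i: "i \<in> I"
    have "L2_inner M (\<lambda>x. c i * E (B i) f x) (\<lambda>x. \<Sum>i\<in>I. c i * E (B i) f x)
        = (\<Sum>j\<in>I. L2_inner M (\<lambda>x. c i * E (B i) f x) (\<lambda>x. c j * E (B j) f x))"
      using L L[OF i] by (rule L2_inner_sum_right)
    then show "L2_inner M (\<lambda>x. c i * E (B i) f x) (\<lambda>x. \<Sum>i\<in>I. c i * E (B i) f x)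
        = (\<Sum>j\<in>I. c i * cnj (c j) * L2_inner M (E (B i) f) (E (B j) f))"
      by (simp add: L2_inner_cmult_left L2_inner_cmult_right mult.assoc)
  qed
  also have "\<dots> = (\<Sum>i\<in>I. \<Sum>j\<in>I. if j = i then c i * cnj (c i) * of_real (measure (\<mu> f) (B i)) else 0)"
    by (intro sum.cong refl) (simp add: orth)
  also have "\<dots> = (\<Sum>i\<in>I. c i * cnj (c i) * of_real (measure (\<mu> f) (B i)))"
    using assms(1) by simp
  also have "\<dots> = complex_of_real (\<Sum>i\<in>I. (cmod (c i))\<^sup>2 * measure (\<mu> f) (B i))"
    by (simp only: of_real_sum of_real_mult complex_norm_square)
  finally show ?thesis by (simp only: of_real_eq_iff)
qed

text \<open>The general \<open>\<phi>\<close> covers both uses: the squared modulus for the isometry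
  and the identity for the inner product.\<close>

lemma integral_simple_comp:
  fixes \<phi> :: "complex \<Rightarrow> 'b::{banach, second_countable_topology}"
  assumes "simple_function borel s" "f \<in> L2 M"
  shows "integrable (\<mu> f) (\<lambda>r. \<phi> (s r))"
    and "(\<integral>r. \<phi> (s r) \<partial>\<mu> f) = (\<Sum>c\<in>range s. measure (\<mu> f) (s -` {c}) *\<^sub>R \<phi> c)"
proof -
  interpret finite_measure "\<mu> f" using assms(2) by (rule finite_measure_\<mu>)
  have R: "finite (range s)" using simple_functionD(1)[OF assms(1)] by simp
  note lev[measurable] = simple_level_set[OF assms(1)]
  have eq: "(\<lambda>r. \<phi> (s r)) = (\<lambda>r. \<Sum>c\<in>range s. indicator (s -` {c}) r *\<^sub>R \<phi> c)"
  proof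
    fix r
    have "(\<Sum>c\<in>range s. indicator (s -` {c}) r *\<^sub>R \<phi> c) = (\<Sum>c\<in>range s. if c = s r then \<phi> (s r) else 0)"
      by (intro sum.cong) (auto simp: indicator_def)
    then show "\<phi> (s r) = (\<Sum>c\<in>range s. indicator (s -` {c}) r *\<^sub>R \<phi> c)"
      using R by simp
  qed
  have int: "integrable (\<mu> f) (\<lambda>r. indicator (s -` {c}) r *\<^sub>R \<phi> c)" for c
    by (intro integrable_scaleR_left integrable_real_indicator) (auto simp: lev less_top[symmetric])
  show "integrable (\<mu> f) (\<lambda>r. \<phi> (s r))"
    unfolding eq by (intro Bochner_Integration.integrable_sum int)
  show "(\<integral>r. \<phi> (s r) \<partial>\<mu> f) = (\<Sum>c\<in>range s. measure (\<mu> f) (s -` {c}) *\<^sub>R \<phi> c)"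
    unfolding eq using int
    by (subst Bochner_Integration.integral_sum) (auto intro!: sum.cong simp: lev less_top[symmetric])
qed

text \<open>Orthogonality of the projections on the level sets turns the left side into the integral
  of the squared modulus. This carries approximations from \<open>L2 (\<mu> f)\<close> over to
  \<open>L2 M\<close>.\<close>

lemma simple_isometry:
  assumes "simple_function borel s" "f \<in> L2 M"
  shows "L2_norm M (simple_spectral_integral E s f) = L2_norm (\<mu> f) s"
proof -
  have "(L2_norm M (simple_spectral_integral E s f))\<^sup>2
      = (\<Sum>c\<in>range s. (cmod c)\<^sup>2 * measure (\<mu> f) (s -` {c}))"
    unfolding simple_spectral_integral_def
    using simple_functionD(1)[OF assms(1)] assms
    by (intro L2_norm_disjoint_sum) (auto simp: simple_level_set disjoint_family_on_def)
  also have "\<dots> = (\<integral>r. (cmod (s r))\<^sup>2 \<partial>\<mu> f)"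
    by (simp add: integral_simple_comp(2)[OF assms, of "\<lambda>c. (cmod c)\<^sup>2"] mult.commute)
  finally show ?thesis
    by (simp add: L2_norm_sq[symmetric] L2_norm_nonneg)
qed

lemma simple_inner:
  assumes "simple_function borel s" "f \<in> L2 M"
  shows "L2_inner M (simple_spectral_integral E s f) f = (\<integral>r. s r \<partial>\<mu> f)"
proof -
  have "L2_inner M (simple_spectral_integral E s f) f
      = (\<Sum>c\<in>range s. c * L2_inner M (E (s -` {c}) f) f)"
    unfolding simple_spectral_integral_def
    using assms by (simp add: L2_inner_sum_left L2_inner_cmult_left L2_cmult E_L2 simple_level_set)
  also have "\<dots> = (\<Sum>c\<in>range s. measure (\<mu> f) (s -` {c}) *\<^sub>R c)"
    using assms by (simp add: E_inner_self measure_\<mu> simple_level_set scaleR_conv_of_real mult.commute)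
  also have "\<dots> = (\<integral>r. s r \<partial>\<mu> f)"
    using integral_simple_comp(2)[OF assms, of "\<lambda>c. c"] by simp
  finally show ?thesis .
qed

lemma simple_L2_\<mu>:
  assumes "simple_function borel s" "f \<in> L2 M"
  shows "s \<in> L2 (\<mu> f)"
  using integral_simple_comp(1)[OF assms, of "\<lambda>c. (cmod c)\<^sup>2"] borel_measurable_simple_function[OF assms(1)]
  by (simp add: L2_def measurable_cong_sets[OF sets_\<mu> refl])

lemma simple_diff_norm:
  assumes "simple_function borel s" "simple_function borel s'" "f \<in> L2 M"
  shows "L2_norm M (\<lambda>x. simple_spectral_integral E s f x - simple_spectral_integral E s' f x)
    = L2_norm (\<mu> f) (\<lambda>r. s r - s' r)"
proof -
  have "L2_norm M (\<lambda>x. simple_spectral_integral E s f x - simple_spectral_integral E s' f x)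
      = L2_norm M (simple_spectral_integral E (\<lambda>r. s r - s' r) f)"
    using assms
    by (intro L2_norm_cong_AE L2_eq_sym[OF simple_diff] L2_measurable L2_diff simple_L2 simple_function_diff)
  also have "\<dots> = L2_norm (\<mu> f) (\<lambda>r. s r - s' r)"
    using assms by (intro simple_isometry simple_function_diff)
  finally show ?thesis .
qed

text \<open>Simple functions that converge pointwise to \<open>F\<close> and are dominated by a
  multiple of it converge in \<open>L2 (\<mu> f)\<close>. The isometry transfers their mutual
  distances to the integrals, and along a selection with geometric rate
  \<open>L2_geometric_Cauchy\<close> supplies the limit.\<close>

lemma spectral_integral_exists:
  assumes f: "f \<in> L2 M" and F: "F \<in> L2 (\<mu> f)"
  shows "\<exists>g. (f, g) \<in> spectral_integral M E F"
proof -
  have F_meas: "F \<in> borel_measurable borel"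
    using L2_measurable[OF F] by (simp add: measurable_cong_sets[OF sets_\<mu> refl])
  obtain s where s: "\<And>i. simple_function borel (s i)" "\<And>r. (\<lambda>i. s i r) \<longlonglongrightarrow> F r"
      "\<And>i r. dist (s i r) 0 \<le> 2 * dist (F r) 0"
    using borel_measurable_implies_sequence_metric[OF F_meas, of 0] by auto
  have sL2: "s i \<in> L2 (\<mu> f)" for i
    using s(1) f by (rule simple_L2_\<mu>)
  note [measurable] = L2_measurable[OF F] L2_measurable[OF sL2]
  have "(\<lambda>i. \<integral>r. (cmod (F r - s i r))\<^sup>2 \<partial>\<mu> f) \<longlonglongrightarrow> (\<integral>r. 0 \<partial>\<mu> f)"
  proof (rule integral_dominated_convergence)
    \<comment> \<open>The approximants have modulus at most \<open>2 * cmod (F r)\<close>, so the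
      error is at most three times \<open>cmod (F r)\<close>; squaring gives 9.\<close>
    show "integrable (\<mu> f) (\<lambda>r. 9 * (cmod (F r))\<^sup>2)"
      using L2_integrable_sq[OF F] by simp
    show "AE r in \<mu> f. (\<lambda>i. (cmod (F r - s i r))\<^sup>2) \<longlonglongrightarrow> 0"
    proof (intro AE_I2)
      fix r
      have "(\<lambda>i. (cmod (F r - s i r))\<^sup>2) \<longlonglongrightarrow> (cmod (F r - F r))\<^sup>2"
        by (intro tendsto_intros s(2))
      then show "(\<lambda>i. (cmod (F r - s i r))\<^sup>2) \<longlonglongrightarrow> 0" by simp
    qed
    show "AE r in \<mu> f. norm ((cmod (F r - s i r))\<^sup>2) \<le> 9 * (cmod (F r))\<^sup>2" for i
    proof (intro AE_I2)
      fix r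
      have "cmod (F r - s i r) \<le> cmod (F r) + cmod (s i r)" by (rule norm_triangle_ineq4)
      also have "\<dots> \<le> 3 * cmod (F r)" using s(3)[of i r] by simp
      finally have "(cmod (F r - s i r))\<^sup>2 \<le> (3 * cmod (F r))\<^sup>2"
        by (intro power_mono) auto
      then show "norm ((cmod (F r - s i r))\<^sup>2) \<le> 9 * (cmod (F r))\<^sup>2"
        by (simp add: power_mult_distrib)
    qed
  qed measurable
  then have lim: "(\<lambda>i. (L2_norm (\<mu> f) (\<lambda>r. F r - s i r))\<^sup>2) \<longlonglongrightarrow> 0"
    by (simp add: L2_norm_sq)
  have "\<exists>i. (L2_norm (\<mu> f) (\<lambda>r. F r - s i r))\<^sup>2 \<le> (1/4) ^ k" for k :: nat
  proof -
    have "\<forall>\<^sub>F i in sequentially. (L2_norm (\<mu> f) (\<lambda>r. F r - s i r))\<^sup>2 < (1/4) ^ k"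
      by (rule order_tendstoD(2)[OF lim]) simp
    then show ?thesis
      by (auto dest!: eventually_happens intro: less_imp_le)
  qed
  \<comment> \<open>Only the rate matters here: the chosen indices may fail to increase with
    k.\<close>
  then obtain n where n: "\<And>k. (L2_norm (\<mu> f) (\<lambda>r. F r - s (n k) r))\<^sup>2 \<le> (1/4) ^ k"
    by metis
  define t where "t = (\<lambda>k. s (n k))"
  have t: "simple_function borel (t k)" for k unfolding t_def by (rule s)
  have tF: "(\<lambda>k. L2_norm (\<mu> f) (\<lambda>r. F r - t k r)) \<longlonglongrightarrow> 0"
  proof (rule tendsto_sandwich[of "\<lambda>_. 0" _ _ "\<lambda>k. (1/2) ^ k"])
    have "L2_norm (\<mu> f) (\<lambda>r. F r - t k r) \<le> (1/2) ^ k" for k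
    proof (rule power2_le_imp_le)
      have "((1/2::real) ^ k)\<^sup>2 = (1/4) ^ k"
        by (simp add: power2_eq_square flip: power_mult_distrib)
      then show "(L2_norm (\<mu> f) (\<lambda>r. F r - t k r))\<^sup>2 \<le> ((1/2) ^ k)\<^sup>2"
        using n[of k] by (simp add: t_def)
    qed simp
    then show "\<forall>\<^sub>F k in sequentially. L2_norm (\<mu> f) (\<lambda>r. F r - t k r) \<le> (1/2) ^ k"
      by simp
  qed (simp_all add: L2_norm_nonneg LIMSEQ_power_zero)
  define g where "g = (\<lambda>k. simple_spectral_integral E (t k) f)"
  have gL2: "g k \<in> L2 M" for k unfolding g_def using t f by (rule simple_L2)
  \<comment> \<open>The increment is the difference of the errors at k and \<open>Suc k\<close>,
    whose squared norms are at most \<open>(1/4) ^ k\<close> and a quarter of that.\<close>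
  have gC: "(L2_norm M (\<lambda>x. g (Suc k) x - g k x))\<^sup>2 \<le> 4 * (1/4) ^ k" for k
  proof -
    have d: "(\<lambda>r. F r - t j r) \<in> L2 (\<mu> f)" for j
      unfolding t_def by (intro L2_diff F sL2)
    have "(L2_norm M (\<lambda>x. g (Suc k) x - g k x))\<^sup>2
        = (L2_norm (\<mu> f) (\<lambda>r. (F r - t k r) + (-1) * (F r - t (Suc k) r)))\<^sup>2"
      unfolding g_def using simple_diff_norm[OF t t f] by simp
    also have "\<dots> \<le> 2 * (L2_norm (\<mu> f) (\<lambda>r. F r - t k r))\<^sup>2
        + 2 * (L2_norm (\<mu> f) (\<lambda>r. (-1) * (F r - t (Suc k) r)))\<^sup>2"
      by (intro L2_norm_add_sq_le L2_cmult d)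
    also have "L2_norm (\<mu> f) (\<lambda>r. (-1) * (F r - t (Suc k) r)) = L2_norm (\<mu> f) (\<lambda>r. F r - t (Suc k) r)"
      by (simp add: L2_norm_def norm_minus_commute)
    also have "2 * (L2_norm (\<mu> f) (\<lambda>r. F r - t k r))\<^sup>2 + 2 * (L2_norm (\<mu> f) (\<lambda>r. F r - t (Suc k) r))\<^sup>2
        \<le> 2 * (1/4) ^ k + 2 * (1/4) ^ Suc k"
      unfolding t_def by (intro add_mono mult_left_mono n) auto
    also have "\<dots> \<le> 4 * (1/4) ^ k" by simp
    finally show ?thesis .
  qed
  note G = L2_geometric_Cauchy[OF gL2 gC]
  have "(f, \<lambda>x. lim (\<lambda>k. g k x)) \<in> spectral_integral M E F"
    unfolding spectral_integral_def using f F G(2,3) t tF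
    by (auto simp: g_def intro!: exI[of _ t])
  then show ?thesis by blast
qed

text \<open>For simple functions this is \<open>simple_inner\<close>. Both sides pass to the limit
  by Cauchy-Schwarz, on the left against \<open>h\<close>, on the right against the constant 1,
  which is square integrable since \<open>\<mu> h\<close> is finite.\<close>

lemma spectral_integral_inner:
  assumes "(h, g) \<in> spectral_integral M E F"
  shows "L2_inner M g h = (\<integral>r. F r \<partial>\<mu> h)"
proof -
  obtain s where h: "h \<in> L2 M" and g: "g \<in> L2 M" and F: "F \<in> L2 (\<mu> h)"
    and s: "\<And>n. simple_function borel (s n)"
    and sF: "(\<lambda>n. L2_norm (\<mu> h) (\<lambda>r. F r - s n r)) \<longlonglongrightarrow> 0"
    and sg: "(\<lambda>n. L2_norm M (\<lambda>x. g x - simple_spectral_integral E (s n) h x)) \<longlonglongrightarrow> 0"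
    using assms unfolding spectral_integral_def by auto
  interpret finite_measure "\<mu> h" using h by (rule finite_measure_\<mu>)
  have one: "(\<lambda>r. 1) \<in> L2 (\<mu> h)" by (simp add: L2_def)
  have sL2: "s n \<in> L2 (\<mu> h)" for n using s h by (rule simple_L2_\<mu>)
  have gs: "(\<lambda>x. simple_spectral_integral E (s n) h x) \<in> L2 M" for n
    using simple_L2[OF s h] .
  have int: "L2_inner (\<mu> h) k (\<lambda>r. 1) = (\<integral>r. k r \<partial>\<mu> h)" for k
    by (simp add: L2_inner_def)
  have "(\<lambda>n. L2_inner M g h - L2_inner M (simple_spectral_integral E (s n) h) h) \<longlonglongrightarrow> 0"
  proof (rule Lim_null_comparison)
    show "(\<lambda>n. L2_norm M (\<lambda>x. g x - simple_spectral_integral E (s n) h x) * L2_norm M h) \<longlonglongrightarrow> 0"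
      using tendsto_mult_right[OF sg, of "L2_norm M h"] by simp
    show "\<forall>\<^sub>F n in sequentially. norm (L2_inner M g h - L2_inner M (simple_spectral_integral E (s n) h) h)
        \<le> L2_norm M (\<lambda>x. g x - simple_spectral_integral E (s n) h x) * L2_norm M h"
      using L2_Cauchy_Schwarz[OF L2_diff[OF g gs] h] by (simp add: L2_inner_diff_left g gs h)
  qed
  then have 1: "(\<lambda>n. L2_inner M g h - (\<integral>r. s n r \<partial>\<mu> h)) \<longlonglongrightarrow> 0"
    by (simp add: simple_inner s h)
  have 2: "(\<lambda>n. (\<integral>r. F r \<partial>\<mu> h) - (\<integral>r. s n r \<partial>\<mu> h)) \<longlonglongrightarrow> 0"
    unfolding int[symmetric]
  proof (rule Lim_null_comparison)
    show "(\<lambda>n. L2_norm (\<mu> h) (\<lambda>r. F r - s n r) * L2_norm (\<mu> h) (\<lambda>r. 1)) \<longlonglongrightarrow> 0"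
      using tendsto_mult_right[OF sF, of "L2_norm (\<mu> h) (\<lambda>r. 1)"] by simp
    show "\<forall>\<^sub>F n in sequentially. norm (L2_inner (\<mu> h) F (\<lambda>r. 1) - L2_inner (\<mu> h) (s n) (\<lambda>r. 1))
        \<le> L2_norm (\<mu> h) (\<lambda>r. F r - s n r) * L2_norm (\<mu> h) (\<lambda>r. 1)"
      using L2_Cauchy_Schwarz[OF L2_diff[OF F sL2] one] by (simp only: L2_inner_diff_left F sL2 one eventually_sequentially) blast
  qed
  show ?thesis
    using tendsto_diff[OF 1 2] by (simp add: tendsto_const_iff)
qed

text \<open>The constant 1 is simple with integral \<open>E UNIV f\<close>, which is
  \<open>f\<close> almost everywhere. By the isometry the sequence that defines \<open>g\<close>
  therefore also converges to \<open>f\<close>. This identifies the value of the unitary group at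
  time 0.\<close>

lemma spectral_integral_one:
  assumes "(f, g) \<in> spectral_integral M E (\<lambda>r. 1)"
  shows "L2_eq M g f"
proof -
  obtain s where f: "f \<in> L2 M" and g: "g \<in> L2 M"
    and s: "\<And>n. simple_function borel (s n)"
    and s1: "(\<lambda>n. L2_norm (\<mu> f) (\<lambda>r. 1 - s n r)) \<longlonglongrightarrow> 0"
    and sg: "(\<lambda>n. L2_norm M (\<lambda>x. g x - simple_spectral_integral E (s n) f x)) \<longlonglongrightarrow> 0"
    using assms unfolding spectral_integral_def by auto
  define S where "S = (\<lambda>n. simple_spectral_integral E (s n) f)"
  have S: "S n \<in> L2 M" for n unfolding S_def using s f by (rule simple_L2)
  have one: "simple_spectral_integral E (\<lambda>r. 1) f = (\<lambda>x. E UNIV f x)"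
    by (simp add: simple_spectral_integral_def)
  have fS: "L2_norm M (\<lambda>x. f x - S n x) = L2_norm (\<mu> f) (\<lambda>r. 1 - s n r)" for n
  proof -
    have "L2_norm M (\<lambda>x. f x - S n x) = L2_norm M (\<lambda>x. E UNIV f x - S n x)"
      using f S E_UNIV[OF f] E_L2[of UNIV f]
      by (intro L2_norm_cong_AE L2_measurable L2_diff) (auto simp: L2_eq_def)
    also have "\<dots> = L2_norm (\<mu> f) (\<lambda>r. 1 - s n r)"
      using simple_diff_norm[of "\<lambda>r. 1", OF _ s f] unfolding one S_def by simp
    finally show ?thesis .
  qed
  have gf: "(\<lambda>x. g x - f x) \<in> L2 M" using f g by (rule L2_diff[rotated])
  have "(L2_norm M (\<lambda>x. g x - f x))\<^sup>2
      \<le> 2 * (L2_norm M (\<lambda>x. g x - S n x))\<^sup>2 + 2 * (L2_norm M (\<lambda>x. f x - S n x))\<^sup>2" for n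
  proof -
    have "(L2_norm M (\<lambda>x. g x - f x))\<^sup>2 = (L2_norm M (\<lambda>x. (g x - S n x) + (S n x - f x)))\<^sup>2"
      by simp
    also have "\<dots> \<le> 2 * (L2_norm M (\<lambda>x. g x - S n x))\<^sup>2 + 2 * (L2_norm M (\<lambda>x. S n x - f x))\<^sup>2"
      using f g S by (intro L2_norm_add_sq_le L2_diff)
    also have "L2_norm M (\<lambda>x. S n x - f x) = L2_norm M (\<lambda>x. f x - S n x)"
      by (simp add: L2_norm_def norm_minus_commute)
    finally show ?thesis .
  qed
  moreover have "(\<lambda>n. 2 * (L2_norm M (\<lambda>x. g x - S n x))\<^sup>2 + 2 * (L2_norm M (\<lambda>x. f x - S n x))\<^sup>2)
      \<longlonglongrightarrow> 2 * 0\<^sup>2 + 2 * 0\<^sup>2"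
    unfolding fS using s1 sg unfolding S_def by (intro tendsto_intros)
  ultimately have "(L2_norm M (\<lambda>x. g x - f x))\<^sup>2 \<le> 2 * 0\<^sup>2 + 2 * 0\<^sup>2"
    by (intro LIMSEQ_le_const) auto
  then have "L2_eq M (\<lambda>x. g x - f x) (\<lambda>x. 0)"
    using gf by (intro L2_eq_zero) auto
  then show ?thesis by (simp add: L2_eq_def)
qed

text \<open>By multiplicativity of \<open>E\<close>, the spectral measure of \<open>E B f\<close> is
  that of \<open>f\<close> restricted to \<open>B\<close>.\<close>

lemma \<mu>_E:
  assumes "B \<in> sets borel" "C \<in> sets borel" "f \<in> L2 M"
  shows "emeasure (\<mu> (E B f)) C = emeasure (\<mu> f) (C \<inter> B)"
proof -
  have "L2_norm M (E C (E B f)) = L2_norm M (E (C \<inter> B) f)"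
    using assms by (intro L2_norm_cong_AE L2_eq_sym[OF E_Int] L2_measurable E_L2) auto
  then show ?thesis using assms by (simp add: emeasure_\<mu> E_L2)
qed

text \<open>A vector h of the spectral subspace of \<open>[-N, -1/N)\<close> lies in the domain of A and satisfies
  \<open>(Ah, h) \<le> -(h, h) / N\<close>, so that h = 0.\<close>

lemma nonneg_imp_\<mu>_neg_null:
  assumes A: "\<And>h g. (h, g) \<in> spectral_integral M E complex_of_real \<Longrightarrow> 0 \<le> Re (L2_inner M g h)"
    and f: "f \<in> L2 M"
  shows "emeasure (\<mu> f) {..<0} = 0"
proof -
  \<comment> \<open>\<open>Suc n\<close> is the N of the comment above, so that the inverse is
    positive; these sets increase to the negative half-line.\<close>
  define B where "B = (\<lambda>n::nat. {- real (Suc n)..<- inverse (real (Suc n))})"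
  have B[measurable]: "B n \<in> sets borel" for n by (simp add: B_def)
  have "emeasure (\<mu> f) (B n) = 0" for n
  proof -
    define h where "h = E (B n) f"
    have h: "h \<in> L2 M" unfolding h_def using B f by (rule E_L2)
    interpret finite_measure "\<mu> h" using h by (rule finite_measure_\<mu>)
    have "emeasure (\<mu> h) (- B n) = 0"
      using \<mu>_E[OF B _ f, of "- B n" n] B by (simp add: h_def borel_comp)
    then have ae: "AE r in \<mu> h. r \<in> B n"
      by (intro AE_I[of _ _ "- B n"]) (auto simp: borel_comp)
    have meas[measurable]: "complex_of_real \<in> borel_measurable (\<mu> h)"
      by (simp add: measurable_cong_sets[OF sets_\<mu> refl])
    have bd: "AE r in \<mu> h. norm r \<le> real (Suc n) \<and> r \<le> - inverse (real (Suc n))"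
      using ae
    proof eventually_elim
      case (elim r)
      then have *: "r \<le> - inverse (real (Suc n))" "- real (Suc n) \<le> r"
        by (auto simp: B_def)
      moreover have "0 < inverse (real (Suc n))" by simp
      ultimately have "r \<le> 0" by linarith
      with * show ?case by (simp del: of_nat_Suc)
    qed
    have ident[measurable]: "(\<lambda>r. r) \<in> borel_measurable (\<mu> h)"
      by (simp add: measurable_cong_sets[OF sets_\<mu> refl])
    have int: "integrable (\<mu> h) (\<lambda>r. r)"
      by (rule integrable_const_bound[of _ "real (Suc n)"]) (use bd in auto)
    have "integrable (\<mu> h) (\<lambda>r. r\<^sup>2)"
    proof (rule integrable_const_bound[of _ "(real (Suc n))\<^sup>2"])
      show "AE r in \<mu> h. norm (r\<^sup>2) \<le> (real (Suc n))\<^sup>2"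
        using bd
      proof eventually_elim
        case (elim r)
        then have "\<bar>r\<bar>\<^sup>2 \<le> (real (Suc n))\<^sup>2" by (intro power_mono) auto
        then show ?case by simp
      qed
    qed measurable
    then have "complex_of_real \<in> L2 (\<mu> h)"
      by (simp add: L2_def)
    then obtain g where g: "(h, g) \<in> spectral_integral M E complex_of_real"
      using spectral_integral_exists[OF h] by blast
    \<comment> \<open>This integral is \<open>(Ah, h)\<close>. It is nonnegative although its
      integrand is almost everywhere at most \<open>- inverse (real (Suc n))\<close>, so the measure
      has total mass 0.\<close>
    have "0 \<le> (\<integral>r. r \<partial>\<mu> h)"
      using A[OF g] spectral_integral_inner[OF g] by simp
    also have "\<dots> \<le> (\<integral>r. - inverse (real (Suc n)) \<partial>\<mu> h)"
      by (intro integral_mono_AE int) (use bd in auto)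
    also have "\<dots> = - inverse (real (Suc n)) * measure (\<mu> h) UNIV"
      by simp
    finally have "measure (\<mu> h) UNIV \<le> 0"
      by (simp add: mult_le_0_iff)
    then have "emeasure (\<mu> h) UNIV = 0"
      by (simp add: emeasure_eq_measure measure_le_0_iff)
    then show ?thesis
      using \<mu>_E[OF B _ f, of UNIV n] by (simp add: h_def)
  qed
  then have null: "emeasure (\<mu> f) (\<Union>n. B n) = 0"
    by (intro emeasure_UN_eq_0) auto
  have "{..<0} \<subseteq> (\<Union>n. B n)"
  proof
    fix r :: real assume "r \<in> {..<0}"
    then have r: "r < 0" by simp
    \<comment> \<open>m places the right endpoint above r and k places the left endpoint below it;
      their maximum does both.\<close>
    obtain m where m: "inverse (real (Suc m)) < - r"
      using reals_Archimedean[of "- r"] r by auto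
    obtain k :: nat where k: "- r < real k" using reals_Archimedean2 by blast
    have "inverse (real (Suc (max m k))) \<le> inverse (real (Suc m))"
      by (intro le_imp_inverse_le) auto
    then have upper: "r < - inverse (real (Suc (max m k)))" using m by linarith
    have "r \<in> B (max m k)"
    proof -
      have "real k \<le> real (Suc (max m k))" by simp
      then have "- real (Suc (max m k)) \<le> r" using k by linarith
      with upper show ?thesis unfolding B_def atLeastLessThan_iff by blast
    qed
    then show "r \<in> (\<Union>n. B n)" by blast
  qed
  with null show ?thesis
    by (rule emeasure_eq_0[rotated]) measurable
qed

end

section \<open>The unitary group\<close>

text \<open>The chord has length \<open>2 * \<bar>sin ((a - b) / 2)\<bar>\<close>, and the sine is
  bounded in modulus by its argument.\<close>

lemma norm_cis_diff_le: "norm (cis a - cis b) \<le> \<bar>a - b\<bar>"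
proof (rule power2_le_imp_le)
  have "(norm (cis a - cis b))\<^sup>2 = (cos a - cos b)\<^sup>2 + (sin a - sin b)\<^sup>2"
    by (simp add: cmod_power2)
  also have "\<dots> = ((cos a)\<^sup>2 + (sin a)\<^sup>2) + ((cos b)\<^sup>2 + (sin b)\<^sup>2) - 2 * cos (a - b)"
    by (simp add: cos_diff power2_eq_square algebra_simps)
  also have "\<dots> = (2 * \<bar>sin ((a - b) / 2)\<bar>)\<^sup>2"
  proof -
    have "2 * ((a - b) / 2) = a - b" by simp
    with cos_double_sin[of "(a - b) / 2"] have "cos (a - b) = 1 - 2 * (sin ((a - b) / 2))\<^sup>2"
      by (simp only:)
    then show ?thesis by (simp add: power_mult_distrib)
  qed
  also have "\<dots> \<le> (2 * \<bar>(a - b) / 2\<bar>)\<^sup>2"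
    by (intro power_mono mult_left_mono abs_sin_x_le_abs_x) auto
  finally show "(norm (cis a - cis b))\<^sup>2 \<le> \<bar>a - b\<bar>\<^sup>2" by simp
qed simp

section \<open>Nested grids on the real line and the approximation of the exponential\<close>

text \<open>The cells of level n have length \<open>4\<^sup>-\<^sup>n\<close>; those indexed by \<open>idx n\<close> fill \<open>[-2\<^sup>n, 2\<^sup>n)\<close>.\<close>

definition cell :: "nat \<Rightarrow> int \<Rightarrow> real set" where
  "cell n k = {r. \<lfloor>4 ^ n * r\<rfloor> = k}"

definition idx :: "nat \<Rightarrow> int set" where
  "idx n = {- (8 ^ n)..<8 ^ n}"

lemma finite_idx[simp]: "finite (idx n)"
  and card_idx: "card (idx n) = 2 * 8 ^ n"
  by (simp_all add: idx_def nat_mult_distrib nat_power_eq)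

lemma cell_borel[measurable]: "cell n k \<in> sets borel"
  unfolding cell_def by measurable

lemma disjoint_cell: "disjoint_family_on (cell n) I"
  by (auto simp: disjoint_family_on_def cell_def)

text \<open>This is the nesting of the grids: passing to the coarser level divides the index by
  4.\<close>

lemma floor_refine: "\<lfloor>4 ^ Suc n * r\<rfloor> div 4 = \<lfloor>4 ^ n * r\<rfloor>" for r :: real
  using floor_divide_real_eq_div[of 4 "4 ^ Suc n * r"] by simp

text \<open>Children of cells in the window of level n have indices from \<open>- 4 * 8 ^ n\<close>
  to \<open>4 * 8 ^ n - 1\<close>, inside the window of level \<open>Suc n\<close>. The remaining
  indices of \<open>idx (Suc n)\<close> belong to newly added cells.\<close>

lemma idx_refine: "l div 4 \<in> idx n \<Longrightarrow> l \<in> idx (Suc n)"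
proof -
  define N :: int where "N = 8 ^ n"
  have "1 \<le> N" by (simp add: N_def)
  moreover assume "l div 4 \<in> idx n"
  then have "- N \<le> l div 4" "l div 4 < N" by (auto simp: idx_def N_def)
  moreover have "l = 4 * (l div 4) + l mod 4" "0 \<le> l mod 4" "l mod 4 < 4" by simp_all
  ultimately have "- (8 * N) \<le> l" "l < 8 * N" by linarith+
  then show ?thesis by (auto simp: idx_def N_def)
qed

lemma cell_refine:
  assumes "k \<in> idx n"
  shows "cell n k = (\<Union>l\<in>{l \<in> idx (Suc n). l div 4 = k}. cell (Suc n) l)"
proof (intro equalityI subsetI)
  fix r assume "r \<in> cell n k"
  then have "\<lfloor>4 ^ Suc n * r\<rfloor> div 4 = k" by (simp only: floor_refine cell_def mem_Collect_eq)
  moreover from this have "\<lfloor>4 ^ Suc n * r\<rfloor> \<in> idx (Suc n)" using assms by (intro idx_refine) (simp only:)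
  moreover have "r \<in> cell (Suc n) \<lfloor>4 ^ Suc n * r\<rfloor>" by (simp only: cell_def mem_Collect_eq)
  ultimately show "r \<in> (\<Union>l\<in>{l \<in> idx (Suc n). l div 4 = k}. cell (Suc n) l)" by blast
next
  fix r assume "r \<in> (\<Union>l\<in>{l \<in> idx (Suc n). l div 4 = k}. cell (Suc n) l)"
  then have "\<lfloor>4 ^ Suc n * r\<rfloor> div 4 = k" by (auto simp only: cell_def)
  then show "r \<in> cell n k" by (simp only: floor_refine cell_def mem_Collect_eq)
qed

text \<open>Scaling by \<open>4 ^ n\<close> turns the interval into the index range, since
  \<open>8 ^ n = 4 ^ n * 2 ^ n\<close>.\<close>

lemma idx_iff: "\<lfloor>4 ^ n * r\<rfloor> \<in> idx n \<longleftrightarrow> - (2 ^ n) \<le> r \<and> r < 2 ^ n" for r :: real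
proof -
  have e: "(8::real) ^ n = 4 ^ n * 2 ^ n" by (simp flip: power_mult_distrib)
  have "\<lfloor>4 ^ n * r\<rfloor> \<in> idx n \<longleftrightarrow> 4 ^ n * - (2 ^ n) \<le> 4 ^ n * r \<and> 4 ^ n * r < 4 ^ n * 2 ^ n"
    by (simp add: idx_def le_floor_iff floor_less_iff e)
  also have "\<dots> \<longleftrightarrow> - (2 ^ n) \<le> r \<and> r < 2 ^ n"
    by (subst mult_le_cancel_left_pos, simp, subst mult_less_cancel_left_pos, simp_all)
  finally show ?thesis .
qed

text \<open>The exponential is evaluated at the left endpoint of the cell containing
  \<open>r\<close>, and written with \<open>cis\<close> so that its Lipschitz bound applies.\<close>

definition exp_approx :: "nat \<Rightarrow> real \<Rightarrow> real \<Rightarrow> complex" where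
  "exp_approx n t r = (if \<lfloor>4 ^ n * r\<rfloor> \<in> idx n then cis (t * (of_int \<lfloor>4 ^ n * r\<rfloor> / 4 ^ n)) else 0)"

lemma exp_approx_measurable: "exp_approx n t \<in> borel_measurable borel"
proof -
  have "(\<lambda>r::real. \<lfloor>4 ^ n * r\<rfloor>) \<in> borel \<rightarrow>\<^sub>M count_space UNIV"
    by measurable
  moreover have "(\<lambda>k. if k \<in> idx n then cis (t * (of_int k / 4 ^ n)) else 0) \<in> count_space UNIV \<rightarrow>\<^sub>M borel"
    by simp
  ultimately show ?thesis
    unfolding exp_approx_def by (rule measurable_compose)
qed

lemma exp_approx_simple: "simple_function borel (exp_approx n t)"
proof (rule simple_function_borel_measurable[OF exp_approx_measurable])
  have "range (exp_approx n t) \<subseteq> insert 0 ((\<lambda>k. cis (t * (of_int k / 4 ^ n))) ` idx n)"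
    by (auto simp: exp_approx_def)
  then have "finite (range (exp_approx n t))"
    by (rule finite_subset) simp
  then show "finite (exp_approx n t ` space borel)"
    by simp
qed

lemma exp_approx_LIMSEQ: "(\<lambda>n. exp_approx n t r) \<longlonglongrightarrow> cis (t * r)"
proof (rule LIM_zero_cancel, rule Lim_null_comparison)
  have "(\<lambda>n. \<bar>t\<bar> * (1/4) ^ n) \<longlonglongrightarrow> \<bar>t\<bar> * 0"
    by (intro tendsto_intros LIMSEQ_power_zero) simp
  then show "(\<lambda>n. \<bar>t\<bar> * (1/4) ^ n) \<longlonglongrightarrow> 0" by simp
  \<comment> \<open>From level N on, r lies in the window and only the mesh error remains.\<close>
  obtain N where N: "\<bar>r\<bar> < 2 ^ N" using real_arch_pow[of 2 "\<bar>r\<bar>"] by auto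
  show "\<forall>\<^sub>F n in sequentially. norm (exp_approx n t r - cis (t * r)) \<le> \<bar>t\<bar> * (1/4) ^ n"
    using eventually_ge_at_top[of N]
  proof eventually_elim
    case (elim n)
    have "(2::real) ^ N \<le> 2 ^ n" using elim by simp
    then have "\<lfloor>4 ^ n * r\<rfloor> \<in> idx n" unfolding idx_iff using N by linarith
    then have "norm (exp_approx n t r - cis (t * r)) \<le> \<bar>t * (of_int \<lfloor>4 ^ n * r\<rfloor> / 4 ^ n) - t * r\<bar>"
      by (simp add: exp_approx_def norm_cis_diff_le)
    also have "t * (of_int \<lfloor>4 ^ n * r\<rfloor> / 4 ^ n) - t * r = t * ((of_int \<lfloor>4 ^ n * r\<rfloor> - 4 ^ n * r) / 4 ^ n)"
      by (simp add: field_simps)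
    also have "\<bar>t * ((of_int \<lfloor>4 ^ n * r\<rfloor> - 4 ^ n * r) / 4 ^ n)\<bar>
        = \<bar>t\<bar> * (\<bar>of_int \<lfloor>4 ^ n * r\<rfloor> - 4 ^ n * r\<bar> / 4 ^ n)"
      unfolding abs_mult abs_divide by simp
    also have "\<dots> \<le> \<bar>t\<bar> * (1 / 4 ^ n)"
    proof (intro mult_left_mono divide_right_mono)
      show "\<bar>of_int \<lfloor>4 ^ n * r\<rfloor> - 4 ^ n * r\<bar> \<le> 1" by linarith
    qed auto
    finally show ?case by (simp add: power_one_over)
  qed
qed

text \<open>The coefficient of \<open>E (cell (Suc n) l) f\<close> in the difference of consecutive
  approximations. The parent of cell l has index \<open>l div 4\<close>; if it lies outside the
  window there is no coarse term.\<close>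

definition refine_coeff :: "nat \<Rightarrow> real \<Rightarrow> int \<Rightarrow> complex" where
  "refine_coeff n t l = cis (t * (of_int l / 4 ^ Suc n)) -
     (if l div 4 \<in> idx n then cis (t * (of_int (l div 4) / 4 ^ n)) else 0)"

definition refine_bound :: "nat \<Rightarrow> real \<Rightarrow> int \<Rightarrow> real" where
  "refine_bound n T l = (if l div 4 \<in> idx n then T / 4 ^ n else 1)"

text \<open>The left endpoints of child and parent differ by \<open>(l mod 4) / 4\<close> of the
  coarse mesh, and the exponential has Lipschitz constant at most \<open>T\<close> in the spectral
  variable. Without a parent in the window a single term of modulus 1 remains.\<close>

lemma refine_coeff_le:
  assumes "\<bar>t\<bar> \<le> T"
  shows "cmod (refine_coeff n t l) \<le> refine_bound n T l"
proof (cases "l div 4 \<in> idx n")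
  case True
  have "l = 4 * (l div 4) + l mod 4" by simp
  then have l: "real_of_int l = 4 * real_of_int (l div 4) + real_of_int (l mod 4)"
    by (metis of_int_add of_int_mult of_int_numeral)
  have m: "0 \<le> l mod 4" "l mod 4 < 4" by simp_all
  have "cmod (refine_coeff n t l) \<le> \<bar>t * (of_int l / 4 ^ Suc n) - t * (of_int (l div 4) / 4 ^ n)\<bar>"
    using True by (simp add: refine_coeff_def norm_cis_diff_le)
  also have "t * (of_int l / 4 ^ Suc n) - t * (of_int (l div 4) / 4 ^ n) = t * (of_int (l mod 4) / 4 / 4 ^ n)"
    unfolding l by (simp add: field_simps)
  also have "\<bar>t * (of_int (l mod 4) / 4 / 4 ^ n)\<bar> = \<bar>t\<bar> * (of_int (l mod 4) / 4 / 4 ^ n)"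
    using m by (simp add: abs_mult)
  also have "\<dots> \<le> T * (1 / 4 ^ n)"
    using assms m by (intro mult_mono divide_right_mono) auto
  finally show ?thesis using True by (simp add: refine_bound_def)
qed (simp add: refine_coeff_def refine_bound_def)

section \<open>Convergence of the approximations, locally uniformly in time\<close>

context spectral_measure
begin

text \<open>The representatives of \<open>E(cell) f\<close> do not depend on t, so this is continuous in t for
  every x.\<close>

definition approx_group :: "('a \<Rightarrow> complex) \<Rightarrow> nat \<Rightarrow> real \<Rightarrow> 'a \<Rightarrow> complex" where
  "approx_group f n t x = (\<Sum>k\<in>idx n. cis (t * (of_int k / 4 ^ n)) * E (cell n k) f x)"

lemma approx_group_L2: "f \<in> L2 M \<Longrightarrow> approx_group f n t \<in> L2 M"
  unfolding approx_group_def by (intro L2_sum L2_cmult E_L2 cell_borel)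

lemma approx_group_simple:
  "f \<in> L2 M \<Longrightarrow> L2_eq M (simple_spectral_integral E (exp_approx n t) f) (approx_group f n t)"
  unfolding approx_group_def
  by (rule simple_partition[OF exp_approx_simple _ _ cell_borel disjoint_cell])
    (auto simp: exp_approx_def cell_def)

text \<open>All dependence on t sits in scalar coefficients. The identities valid only almost
  everywhere are the countably many that express \<open>E (cell n k) f\<close> through child cells,
  so one null set serves every n and every t.\<close>

lemma approx_group_refine:
  assumes f: "f \<in> L2 M"
  shows "AE x in M. \<forall>n t. approx_group f (Suc n) t x - approx_group f n t x
    = (\<Sum>l\<in>idx (Suc n). refine_coeff n t l * E (cell (Suc n) l) f x)"
proof -
  have "AE x in M. \<forall>n. \<forall>k\<in>idx n. E (cell n k) f x = (\<Sum>l\<in>{l \<in> idx (Suc n). l div 4 = k}. E (cell (Suc n) l) f x)"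
  proof (unfold AE_all_countable, intro allI AE_finite_allI)
    fix n k assume k: "k \<in> idx n"
    show "AE x in M. E (cell n k) f x = (\<Sum>l\<in>{l \<in> idx (Suc n). l div 4 = k}. E (cell (Suc n) l) f x)"
      using E_UN[OF _ cell_borel disjoint_cell f, of "{l \<in> idx (Suc n). l div 4 = k}" "Suc n"]
      unfolding cell_refine[OF k] L2_eq_def by simp
  qed simp
  then show ?thesis
  proof eventually_elim
    case (elim x)
    show ?case
    proof (intro allI)
      fix n t
      \<comment> \<open>These are the children with a parent in the window; grouping them by parent
        turns the double sum into a sum over \<open>?S\<close>.\<close>
      let ?S = "{l \<in> idx (Suc n). l div 4 \<in> idx n}"
      let ?h = "\<lambda>l. cis (t * (of_int (l div 4) / 4 ^ n)) * E (cell (Suc n) l) f x"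
      have "approx_group f n t x = (\<Sum>k\<in>idx n. \<Sum>l\<in>{l \<in> ?S. l div 4 = k}. ?h l)"
        unfolding approx_group_def
      proof (rule sum.cong[OF refl])
        fix k assume k: "k \<in> idx n"
        then have S: "{l \<in> idx (Suc n). l div 4 = k} = {l \<in> ?S. l div 4 = k}" by blast
        show "cis (t * (of_int k / 4 ^ n)) * E (cell n k) f x = (\<Sum>l\<in>{l \<in> ?S. l div 4 = k}. ?h l)"
          unfolding elim[rule_format, OF k] S sum_distrib_left by (rule sum.cong) simp_all
      qed
      also have "\<dots> = (\<Sum>l\<in>?S. ?h l)"
        by (rule sum.group) (simp, simp, blast)
      also have "\<dots> = (\<Sum>l\<in>idx (Suc n). if l div 4 \<in> idx n then ?h l else 0)"
        by (rule sum.inter_filter) simp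
      finally have coarse: "approx_group f n t x = (\<Sum>l\<in>idx (Suc n). if l div 4 \<in> idx n then ?h l else 0)" .
      show "approx_group f (Suc n) t x - approx_group f n t x
          = (\<Sum>l\<in>idx (Suc n). refine_coeff n t l * E (cell (Suc n) l) f x)"
        unfolding coarse unfolding approx_group_def sum_subtractf[symmetric]
      proof (rule sum.cong[OF refl])
        fix l
        show "cis (t * (of_int l / 4 ^ Suc n)) * E (cell (Suc n) l) f x - (if l div 4 \<in> idx n then ?h l else 0)
            = refine_coeff n t l * E (cell (Suc n) l) f x"
          by (cases "l div 4 \<in> idx n")
            (simp_all only: refine_coeff_def left_diff_distrib if_True if_False mult_zero_left)
      qed
    qed
  qed
qed

text \<open>A majorant of the squared increment that is free of t; the cardinality is the factor
  lost by Cauchy-Schwarz over the cells.\<close>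

definition refine_majorant :: "('a \<Rightarrow> complex) \<Rightarrow> real \<Rightarrow> nat \<Rightarrow> 'a \<Rightarrow> real" where
  "refine_majorant f T n x =
     real (card (idx (Suc n))) * (\<Sum>l\<in>idx (Suc n). (refine_bound n T l)\<^sup>2 * (cmod (E (cell (Suc n) l) f x))\<^sup>2)"

lemma refine_majorant_nonneg: "0 \<le> refine_majorant f T n x"
  by (auto simp: refine_majorant_def intro!: mult_nonneg_nonneg sum_nonneg)

lemma approx_group_step:
  assumes "f \<in> L2 M"
  shows "AE x in M. \<forall>n t T. \<bar>t\<bar> \<le> T \<longrightarrow>
    (cmod (approx_group f (Suc n) t x - approx_group f n t x))\<^sup>2 \<le> refine_majorant f T n x"
  using approx_group_refine[OF assms]
proof eventually_elim
  case (elim x)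
  show ?case
  proof (intro allI impI)
    fix n :: nat and t T :: real assume t: "\<bar>t\<bar> \<le> T"
    let ?e = "\<lambda>l. cmod (E (cell (Suc n) l) f x)"
    have "cmod (approx_group f (Suc n) t x - approx_group f n t x)
        \<le> (\<Sum>l\<in>idx (Suc n). cmod (refine_coeff n t l) * ?e l)"
      using elim by (simp add: norm_mult[symmetric] norm_sum)
    also have "\<dots> \<le> (\<Sum>l\<in>idx (Suc n). refine_bound n T l * ?e l)"
      by (intro sum_mono mult_right_mono refine_coeff_le t) auto
    finally have "(cmod (approx_group f (Suc n) t x - approx_group f n t x))\<^sup>2
        \<le> (\<Sum>l\<in>idx (Suc n). 1 * (refine_bound n T l * ?e l))\<^sup>2"
      by (intro power_mono) auto
    also have "\<dots> \<le> (\<Sum>l\<in>idx (Suc n). 1\<^sup>2) * (\<Sum>l\<in>idx (Suc n). (refine_bound n T l * ?e l)\<^sup>2)"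
      by (rule Cauchy_Schwarz_ineq_sum)
    finally show "(cmod (approx_group f (Suc n) t x - approx_group f n t x))\<^sup>2 \<le> refine_majorant f T n x"
      by (simp add: refine_majorant_def power_mult_distrib)
  qed
qed

lemma refine_majorant_integrable: "f \<in> L2 M \<Longrightarrow> integrable M (refine_majorant f T n)"
  unfolding refine_majorant_def
  by (intro integrable_mult_right Bochner_Integration.integrable_sum L2_integrable_sq E_L2 cell_borel)

text \<open>Cells with a parent in the window carry the factor \<open>(T / 4 ^ n)^2\<close> and
  together at most the total mass; the others lie in the tail. Both contributions are of order
  \<open>(1/16) ^ n\<close>, and there are \<open>2 * 8 ^ Suc n = 16 * 8 ^ n\<close> cells.\<close>

lemma refine_majorant_integral_le:
  assumes f: "f \<in> L2 M"
    and tail: "measure (\<mu> f) (- {- (2 ^ n)..<2 ^ n}) \<le> K * (1/16) ^ n"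
  shows "(\<integral>x. refine_majorant f T n x \<partial>M) \<le> 16 * (T\<^sup>2 * measure (\<mu> f) UNIV + K) * (1/2) ^ n"
proof -
  interpret finite_measure "\<mu> f" using f by (rule finite_measure_\<mu>)
  let ?m = "\<lambda>l. measure (\<mu> f) (cell (Suc n) l)"
  let ?I = "{l \<in> idx (Suc n). l div 4 \<in> idx n}" and ?J = "{l \<in> idx (Suc n). l div 4 \<notin> idx n}"
  have eq: "measure (\<mu> f) (\<Union>l\<in>S. cell (Suc n) l) = (\<Sum>l\<in>S. ?m l)" if "finite S" for S
    using that disjoint_cell by (intro finite_measure_finite_Union) auto
  have sI: "(\<Sum>l\<in>?I. ?m l) \<le> measure (\<mu> f) UNIV"
    by (subst eq[symmetric]) (auto intro!: finite_measure_mono)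
  have "(\<Union>l\<in>?J. cell (Suc n) l) \<subseteq> - {- (2 ^ n)..<2 ^ n}"
  proof
    fix r assume "r \<in> (\<Union>l\<in>?J. cell (Suc n) l)"
    then have "\<lfloor>4 ^ Suc n * r\<rfloor> div 4 \<notin> idx n" by (auto simp: cell_def)
    then show "r \<in> - {- (2 ^ n)..<2 ^ n}"
      unfolding floor_refine idx_iff by auto
  qed
  then have sJ: "(\<Sum>l\<in>?J. ?m l) \<le> K * (1/16) ^ n"
    by (subst eq[symmetric]) (auto intro!: order_trans[OF finite_measure_mono tail])
  have "(\<integral>x. refine_majorant f T n x \<partial>M)
      = real (card (idx (Suc n))) * (\<Sum>l\<in>idx (Suc n). (refine_bound n T l)\<^sup>2 * ?m l)"
    unfolding refine_majorant_def
    using L2_integrable_sq[OF E_L2[OF cell_borel f]] f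
    by (simp add: Bochner_Integration.integral_sum measure_\<mu> L2_norm_sq)
  also have "(\<Sum>l\<in>idx (Suc n). (refine_bound n T l)\<^sup>2 * ?m l)
      = (\<Sum>l\<in>idx (Suc n). (if l div 4 \<in> idx n then (T / 4 ^ n)\<^sup>2 * ?m l else 0)
          + (if l div 4 \<notin> idx n then ?m l else 0))"
    by (intro sum.cong) (auto simp: refine_bound_def)
  also have "\<dots> = (T / 4 ^ n)\<^sup>2 * (\<Sum>l\<in>?I. ?m l) + (\<Sum>l\<in>?J. ?m l)"
    by (subst sum_distrib_left) (simp only: sum.distrib sum.inter_filter[OF finite_idx])
  also have "real (card (idx (Suc n))) * ((T / 4 ^ n)\<^sup>2 * (\<Sum>l\<in>?I. ?m l) + (\<Sum>l\<in>?J. ?m l))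
      \<le> real (card (idx (Suc n))) * ((T / 4 ^ n)\<^sup>2 * measure (\<mu> f) UNIV + K * (1/16) ^ n)"
    by (intro mult_left_mono add_mono sI sJ) auto
  also have "(T / 4 ^ n)\<^sup>2 = T\<^sup>2 * (1/16) ^ n"
  proof -
    have "((4::real) ^ n)\<^sup>2 = 16 ^ n" by (simp add: power2_eq_square flip: power_mult_distrib)
    then show ?thesis by (simp add: power_divide)
  qed
  also have "real (card (idx (Suc n))) * (T\<^sup>2 * (1/16) ^ n * measure (\<mu> f) UNIV + K * (1/16) ^ n)
      = 16 * (T\<^sup>2 * measure (\<mu> f) UNIV + K) * (8 ^ n * (1/16) ^ n)"
    by (simp add: card_idx algebra_simps)
  also have "(8::real) ^ n * (1/16) ^ n = (1/2) ^ n"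
    by (simp flip: power_mult_distrib)
  finally show ?thesis .
qed

text \<open>At almost every x the limit is locally uniform in t, which gives continuity; for each
  fixed t it is also the \<open>L2\<close> limit, which identifies it with the spectral integral.
  One pointwise \<open>lim\<close> for both makes the representatives at different times fit
  together.\<close>

lemma exp_group_continuous_version:
  assumes f: "f \<in> L2 M"
    and tail: "\<And>n. measure (\<mu> f) (- {- (2 ^ n)..<2 ^ n}) \<le> K * (1/16) ^ n"
  defines "u \<equiv> \<lambda>t x. lim (\<lambda>n. approx_group f n t x)"
  shows "AE x in M. continuous_on UNIV (\<lambda>t. u t x)"
    and "(f, u t) \<in> spectral_integral M E (\<lambda>r. exp (\<i> * complex_of_real t * complex_of_real r))"
proof -
  \<comment> \<open>Integer values of T cover the real line and keep the exceptional set a countable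
    union. The weight \<open>3/4\<close> lies between the decay rate \<open>1/2\<close> and
    1.\<close>
  have "AE x in M. \<forall>T::nat. summable (\<lambda>n. refine_majorant f (real T) n x / (3/4) ^ n)"
    unfolding AE_all_countable
  proof
    fix T :: nat
    show "AE x in M. summable (\<lambda>n. refine_majorant f (real T) n x / (3/4) ^ n)"
      by (rule AE_summable_of_geometric_integrals(2)[OF refine_majorant_integrable[OF f]
          refine_majorant_nonneg refine_majorant_integral_le[OF f tail]]) auto
  qed
  then show "AE x in M. continuous_on UNIV (\<lambda>t. u t x)"
    using approx_group_step[OF f]
  proof eventually_elim
    case (elim x)
    let ?U = "\<lambda>n t. approx_group f n t x"
    have cont: "continuous_on {- real T..real T} (\<lambda>t. u t x)" for T :: nat
    proof -
      let ?S = "{- real T..real T}"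
      let ?L = "\<lambda>t. (\<Sum>n. ?U (Suc n) t - ?U n t)"
      \<comment> \<open>The M-test is applied to the telescoping series of increments; the limit
        itself reappears after adding \<open>?U 0 t\<close>.\<close>
      have "uniform_limit ?S (\<lambda>n t. \<Sum>i<n. ?U (Suc i) t - ?U i t) ?L sequentially"
      proof (rule Weierstrass_m_test_ev)
        show "summable (\<lambda>n. sqrt (refine_majorant f (real T) n x))"
          using elim(1) refine_majorant_nonneg by (intro sqrt_summable_of_weighted[where p = "3/4"]) auto
        have "cmod (?U (Suc n) t - ?U n t) \<le> sqrt (refine_majorant f (real T) n x)" if "t \<in> ?S" for n t
          using elim(2) that by (intro real_le_rsqrt) auto
        then show "\<forall>\<^sub>F n in sequentially. \<forall>t\<in>?S. cmod (?U (Suc n) t - ?U n t) \<le> sqrt (refine_majorant f (real T) n x)"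
          by simp
      qed
      moreover have "(\<lambda>n t. \<Sum>i<n. ?U (Suc i) t - ?U i t) = (\<lambda>n t. ?U n t - ?U 0 t)"
        by (intro ext sum_lessThan_telescope)
      ultimately have lim: "uniform_limit ?S (\<lambda>n t. ?U n t - ?U 0 t) ?L sequentially"
        by simp
      have Uc: "continuous_on ?S (?U n)" for n
        unfolding approx_group_def cis_conv_exp by (intro continuous_intros)
      have "continuous_on ?S ?L"
        by (rule uniform_limit_theorem[OF _ lim]) (auto intro!: continuous_intros Uc always_eventually)
      then have "continuous_on ?S (\<lambda>t. ?L t + ?U 0 t)"
        by (intro continuous_intros Uc)
      moreover have "u t x = ?L t + ?U 0 t" if "t \<in> ?S" for t
      proof -
        have "(\<lambda>n. (?U n t - ?U 0 t) + ?U 0 t) \<longlonglongrightarrow> ?L t + ?U 0 t"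
          by (intro tendsto_add tendsto_const tendsto_uniform_limitI[OF lim that])
        then show ?thesis unfolding u_def by (intro limI) simp
      qed
      ultimately show ?thesis
        using continuous_on_cong[of ?S ?S "\<lambda>t. u t x" "\<lambda>t. ?L t + ?U 0 t"] by blast
    qed
    show ?case
    proof (rule continuous_at_imp_continuous_on, rule ballI)
      fix t :: real
      obtain T :: nat where "\<bar>t\<bar> < real T" using reals_Archimedean2 by blast
      then have "t \<in> interior {- real T..real T}" by auto
      then show "isCont (\<lambda>t. u t x) t"
        by (rule continuous_on_interior[OF cont])
    qed
  qed
  have G: "approx_group f n t \<in> L2 M" for n using f by (rule approx_group_L2)
  \<comment> \<open>For fixed t the majorant with \<open>T = \<bar>t\<bar>\<close> controls the norm
    of the increment.\<close>
  have "(L2_norm M (\<lambda>x. approx_group f (Suc n) t x - approx_group f n t x))\<^sup>2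
      \<le> 16 * (\<bar>t\<bar>\<^sup>2 * measure (\<mu> f) UNIV + K) * (1/2) ^ n" for n
  proof -
    have "(L2_norm M (\<lambda>x. approx_group f (Suc n) t x - approx_group f n t x))\<^sup>2
        \<le> (\<integral>x. refine_majorant f \<bar>t\<bar> n x \<partial>M)"
      unfolding L2_norm_sq
    proof (rule integral_mono_AE)
      show "AE x in M. (cmod (approx_group f (Suc n) t x - approx_group f n t x))\<^sup>2 \<le> refine_majorant f \<bar>t\<bar> n x"
        using approx_group_step[OF f] by eventually_elim simp
    qed (intro L2_integrable_sq L2_diff G refine_majorant_integrable f)+
    also note refine_majorant_integral_le[OF f tail]
    finally show ?thesis .
  qed
  note C = L2_geometric_Cauchy[OF G this]
  let ?F = "\<lambda>r. exp (\<i> * complex_of_real t * complex_of_real r)"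
  have F: "?F r = cis (t * r)" for r by (simp add: cis_conv_exp mult.assoc)
  interpret finite_measure "\<mu> f" using f by (rule finite_measure_\<mu>)
  have uL2: "u t \<in> L2 M" using C(2) by (simp add: u_def)
  have F_meas[measurable]: "?F \<in> borel_measurable (\<mu> f)"
    unfolding measurable_cong_sets[OF sets_\<mu> refl]
    by (intro borel_measurable_continuous_onI continuous_intros)
  have ex_meas[measurable]: "exp_approx n t \<in> borel_measurable (\<mu> f)" for n
    unfolding measurable_cong_sets[OF sets_\<mu> refl] by (rule exp_approx_measurable)
  have FL2: "?F \<in> L2 (\<mu> f)"
    using F_meas by (simp add: L2_def F)
  have "(\<lambda>n. \<integral>r. (cmod (?F r - exp_approx n t r))\<^sup>2 \<partial>\<mu> f) \<longlonglongrightarrow> (\<integral>r. 0 \<partial>\<mu> f)"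
  proof (rule integral_dominated_convergence)
    show "AE r in \<mu> f. (\<lambda>n. (cmod (?F r - exp_approx n t r))\<^sup>2) \<longlonglongrightarrow> 0"
    proof (intro AE_I2)
      fix r
      have "(\<lambda>n. (cmod (?F r - exp_approx n t r))\<^sup>2) \<longlonglongrightarrow> (cmod (cis (t * r) - cis (t * r)))\<^sup>2"
        unfolding F by (intro tendsto_intros exp_approx_LIMSEQ)
      then show "(\<lambda>n. (cmod (?F r - exp_approx n t r))\<^sup>2) \<longlonglongrightarrow> 0" by simp
    qed
    show "AE r in \<mu> f. norm ((cmod (?F r - exp_approx n t r))\<^sup>2) \<le> 2\<^sup>2" for n
    proof (intro AE_I2)
      fix r
      have "cmod (?F r - exp_approx n t r) \<le> cmod (cis (t * r)) + cmod (exp_approx n t r)"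
        unfolding F by (rule norm_triangle_ineq4)
      also have "\<dots> \<le> 2" by (simp add: exp_approx_def)
      finally show "norm ((cmod (?F r - exp_approx n t r))\<^sup>2) \<le> 2\<^sup>2"
        using power_mono[of "cmod (?F r - exp_approx n t r)" 2 2] by simp
    qed
  qed simp_all
  then have "(\<lambda>n. sqrt (\<integral>r. (cmod (?F r - exp_approx n t r))\<^sup>2 \<partial>\<mu> f)) \<longlonglongrightarrow> sqrt 0"
    by (intro tendsto_intros) simp
  then have s1: "(\<lambda>n. L2_norm (\<mu> f) (\<lambda>r. ?F r - exp_approx n t r)) \<longlonglongrightarrow> 0"
    by (simp add: L2_norm_def)
  have "L2_norm M (\<lambda>x. u t x - simple_spectral_integral E (exp_approx n t) f x)
      = L2_norm M (\<lambda>x. u t x - approx_group f n t x)" for n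
    using approx_group_simple[OF f, of n t] uL2 G simple_L2[OF exp_approx_simple f, of n t]
    by (intro L2_norm_cong_AE L2_measurable L2_diff) (auto simp: L2_eq_def)
  then have s2: "(\<lambda>n. L2_norm M (\<lambda>x. u t x - simple_spectral_integral E (exp_approx n t) f x)) \<longlonglongrightarrow> 0"
    using C(3) by (simp add: u_def)
  show "(f, u t) \<in> spectral_integral M E ?F"
    unfolding spectral_integral_def
    using f uL2 FL2 exp_approx_simple s1 s2 by (auto intro!: exI[of _ "\<lambda>n. exp_approx n t"])
qed

text \<open>Chebyshev's inequality: the negative half-line is null, and for
  \<open>r \<ge> 2 ^ n\<close> the squared power is at least \<open>16 ^ n\<close> since
  \<open>\<delta> \<ge> 2\<close>. \<open>K\<close> is the integral of the squared power.\<close>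

lemma tail_bound:
  assumes f: "f \<in> L2 M" and neg: "emeasure (\<mu> f) {..<0} = 0" and \<delta>: "2 \<le> \<delta>"
    and F: "(\<lambda>r. complex_of_real (if 0 \<le> r then r powr \<delta> else 0)) \<in> L2 (\<mu> f)"
  shows "\<exists>K. \<forall>n. measure (\<mu> f) (- {- (2 ^ n)..<2 ^ n}) \<le> K * (1/16) ^ n"
proof (intro exI allI)
  interpret finite_measure "\<mu> f" using f by (rule finite_measure_\<mu>)
  fix n :: nat
  let ?F = "\<lambda>r. complex_of_real (if 0 \<le> r then r powr \<delta> else 0)"
  have "(\<integral>r. 16 ^ n * indicator (- {- (2 ^ n)..<2 ^ n}) r \<partial>\<mu> f) \<le> (\<integral>r. (cmod (?F r))\<^sup>2 \<partial>\<mu> f)"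
  proof (rule integral_mono_AE)
    show "integrable (\<mu> f) (\<lambda>r. (16::real) ^ n * indicator (- {- (2 ^ n)..<2 ^ n}) r)"
      by (intro integrable_mult_right integrable_real_indicator) (auto simp: less_top[symmetric])
    show "integrable (\<mu> f) (\<lambda>r. (cmod (?F r))\<^sup>2)" using F by (rule L2_integrable_sq)
    have "AE r in \<mu> f. \<not> r < 0"
      by (rule AE_I[of _ _ "{..<0}"]) (auto simp: neg)
    then show "AE r in \<mu> f. 16 ^ n * indicator (- {- (2 ^ n)..<2 ^ n}) r \<le> (cmod (?F r))\<^sup>2"
    proof eventually_elim
      case (elim r)
      show ?case
      proof (cases "r < 2 ^ n")
        case True
        have "- (2 ^ n) \<le> (0::real)" by simp
        then show ?thesis using elim True by auto
      next
        case False
        then have r: "2 ^ n \<le> r" by simp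
        have r1: "1 \<le> r" using r one_le_power[of "2::real" n] by linarith
        have "(4::real) ^ n = (2 ^ n) ^ 2" by (simp add: power2_eq_square flip: power_mult_distrib)
        also have "\<dots> \<le> r ^ 2" by (intro power_mono r) simp
        also have "\<dots> = r powr 2" using r1 by (simp add: powr_numeral)
        also have "\<dots> \<le> r powr \<delta>" using r1 \<delta> by (intro powr_mono)
        finally have "(4 ^ n)\<^sup>2 \<le> (r powr \<delta>)\<^sup>2" by (intro power_mono) auto
        moreover have "((4::real) ^ n)\<^sup>2 = 16 ^ n" by (simp add: power2_eq_square flip: power_mult_distrib)
        ultimately show ?thesis using r1 r by (simp add: indicator_def)
      qed
    qed
  qed
  then have "16 ^ n * measure (\<mu> f) (- {- (2 ^ n)..<2 ^ n}) \<le> (\<integral>r. (cmod (?F r))\<^sup>2 \<partial>\<mu> f)"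
    by simp
  then show "measure (\<mu> f) (- {- (2 ^ n)..<2 ^ n}) \<le> (\<integral>r. (cmod (?F r))\<^sup>2 \<partial>\<mu> f) * (1/16) ^ n"
    by (simp add: field_simps power_one_over)
qed

end

section \<open>The elliptic operator\<close>

text \<open>The null set in the ellipticity condition may depend on the vector, so the pointwise
  inequality is transferred from a countable dense set of vectors.\<close>

lemma elliptic_form_self_nonneg:
  fixes \<Omega> :: "(real ^ 'd::finite) set"
  assumes "\<And>\<xi> :: complex ^ 'd. AE x in lebesgue_on \<Omega>.
    0 \<le> Re (\<Sum>j\<in>UNIV. \<Sum>k\<in>UNIV. complex_of_real (a k j x) * \<xi> $ j * cnj (\<xi> $ k))"
  shows "0 \<le> Re (elliptic_form \<Omega> a u u)"
proof -
  define Q where "Q = (\<lambda>x (\<xi> :: complex ^ 'd).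
    \<Sum>j\<in>UNIV. \<Sum>k\<in>UNIV. complex_of_real (a k j x) * \<xi> $ j * cnj (\<xi> $ k))"
  \<comment> \<open>The conjugation matches the order of indices: the unconjugated factor carries j
    in \<open>Q\<close> but k in the form.\<close>
  define G where "G = (\<lambda>x. \<chi> j. cnj (weak_deriv \<Omega> j u x))"
  obtain D :: "(complex ^ 'd) set" where D: "countable D"
    "\<And>U. open U \<Longrightarrow> U \<noteq> {} \<Longrightarrow> \<exists>d\<in>D. d \<in> U"
    using countable_dense_setE by blast
  have clD: "closure D = UNIV"
    using D(2)[of "- closure D"] closure_subset[of D] by auto
  have "AE x in lebesgue_on \<Omega>. \<forall>\<xi>\<in>D. 0 \<le> Re (Q x \<xi>)"
    using assms D(1) by (simp add: AE_ball_countable Q_def)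
  then have ae: "AE x in lebesgue_on \<Omega>. 0 \<le> Re (Q x (G x))"
  proof eventually_elim
    case (elim x)
    show ?case
    proof (rule continuous_ge_on_closure[where f = "\<lambda>\<xi>. Re (Q x \<xi>)" and S = D])
      show "continuous_on (closure D) (\<lambda>\<xi>. Re (Q x \<xi>))"
        unfolding Q_def by (intro continuous_intros)
    qed (use elim clD in auto)
  qed
  have form: "elliptic_form \<Omega> a u u = (\<integral>x. Q x (G x) \<partial>lebesgue_on \<Omega>)"
    unfolding elliptic_form_def Q_def G_def by (simp add: mult.assoc mult.left_commute mult.commute)
  show ?thesis
  \<comment> \<open>Without integrability the integral has the default value 0.\<close>
  proof (cases "integrable (lebesgue_on \<Omega>) (\<lambda>x. Q x (G x))")
    case True
    have "0 \<le> (\<integral>x. Re (Q x (G x)) \<partial>lebesgue_on \<Omega>)"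
      using ae by (rule integral_nonneg_AE)
    then show ?thesis using True by (simp add: form)
  qed (simp add: form not_integrable_integral_eq)
qed

theorem corollary6p12:
  fixes \<Omega> :: "(real ^ 'd::finite) set"
    and a :: "'d \<Rightarrow> 'd \<Rightarrow> real ^ 'd \<Rightarrow> real"
    and \<delta> :: real
    and f :: "real ^ 'd \<Rightarrow> complex"
  assumes "open \<Omega>" and "\<Omega> \<noteq> {}"
    and "\<And>k j x. x \<in> \<Omega> \<Longrightarrow> a k j x = a j k x"
    and "\<And>k j. a k j \<in> borel_measurable (lebesgue_on \<Omega>)"
    and "\<And>k j. bounded (a k j ` \<Omega>)"
    and "\<exists>\<eta>>0. \<forall>\<xi> :: complex ^ 'd. AE x in lebesgue_on \<Omega>.
           Re (\<Sum>j\<in>UNIV. \<Sum>k\<in>UNIV. complex_of_real (a k j x) * \<xi> $ j * cnj (\<xi> $ k)) \<ge> \<eta> * (norm \<xi>)\<^sup>2"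
    and "\<delta> > 2"
    and "f \<in> Domain (fractional_power (lebesgue_on \<Omega>) (form_operator \<Omega> a) \<delta>)"
  shows "(\<exists>u. continuous_representative (lebesgue_on \<Omega>) (form_operator \<Omega> a) f u) \<and>
         (\<forall>u. continuous_representative (lebesgue_on \<Omega>) (form_operator \<Omega> a) f u \<longrightarrow>
            (AE x in lebesgue_on \<Omega>. ((\<lambda>t. u t x) \<longlongrightarrow> f x) (at_right 0)))"
proof (intro conjI allI impI)
  let ?M = "lebesgue_on \<Omega>" and ?A = "form_operator \<Omega> a"
  let ?P = "\<lambda>r. complex_of_real (if 0 \<le> r then r powr \<delta> else 0)"
  obtain E g where E: "spectral_resolution ?M ?A E" and fg: "(f, g) \<in> spectral_integral ?M E ?P"
    using assms(8) unfolding fractional_power_def functional_calculus_def by auto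
  interpret spectral_measure ?M E
    using E by unfold_locales (simp add: spectral_resolution_def)
  have f: "f \<in> L2 ?M" and P: "?P \<in> L2 (\<mu> f)"
    using fg by (auto simp: spectral_integral_def)
  obtain \<eta> where \<eta>: "\<eta> > 0"
    "\<And>\<xi> :: complex ^ 'd. AE x in ?M.
       Re (\<Sum>j\<in>UNIV. \<Sum>k\<in>UNIV. complex_of_real (a k j x) * \<xi> $ j * cnj (\<xi> $ k)) \<ge> \<eta> * (norm \<xi>)\<^sup>2"
    using assms(6) by blast
  have ell: "AE x in ?M. 0 \<le> Re (\<Sum>j\<in>UNIV. \<Sum>k\<in>UNIV. complex_of_real (a k j x) * \<xi> $ j * cnj (\<xi> $ k))"
    for \<xi> :: "complex ^ 'd"
    using \<eta>(2)[of \<xi>]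
  proof eventually_elim
    case (elim x)
    have "0 \<le> \<eta> * (norm \<xi>)\<^sup>2" using \<eta>(1) by simp
    then show ?case using elim by (rule order_trans)
  qed
  have "emeasure (\<mu> f) {..<0} = 0"
  proof (rule nonneg_imp_\<mu>_neg_null[OF _ f])
    fix h g assume "(h, g) \<in> spectral_integral ?M E complex_of_real"
    then have "(h, g) \<in> ?A" using E by (simp add: spectral_resolution_def)
    \<comment> \<open>The defining identity of the operator is tested with \<open>v = h\<close>,
      which lies in \<open>H1_0 \<Omega>\<close>.\<close>
    then have "L2_inner ?M g h = elliptic_form \<Omega> a h h" by (auto simp: form_operator_def)
    then show "0 \<le> Re (L2_inner ?M g h)"
      using elliptic_form_self_nonneg[OF ell] by simp
  qed
  then obtain K where K: "\<And>n. measure (\<mu> f) (- {- (2 ^ n)..<2 ^ n}) \<le> K * (1/16) ^ n"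
    using tail_bound[OF f _ _ P] assms(7) by auto
  show "\<exists>u. continuous_representative ?M ?A f u"
    unfolding continuous_representative_def
  proof (intro exI conjI allI)
    show "AE x in ?M. continuous_on UNIV (\<lambda>t. lim (\<lambda>n. approx_group f n t x))"
      by (rule exp_group_continuous_version(1)[OF f K])
    show "(f, \<lambda>x. lim (\<lambda>n. approx_group f n t x)) \<in> unitary_group ?M ?A t" for t
      unfolding unitary_group_def functional_calculus_def
      using exp_group_continuous_version(2)[OF f K, of t] E by blast
  qed
next
  let ?M = "lebesgue_on \<Omega>" and ?A = "form_operator \<Omega> a"
  fix u assume u: "continuous_representative ?M ?A f u"
  then have "(f, u 0) \<in> unitary_group ?M ?A 0" by (simp add: continuous_representative_def)
  \<comment> \<open>At time 0 the integrand is the constant 1, whichever resolution the membership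
    provides.\<close>
  then obtain E where E: "spectral_resolution ?M ?A E" and fu: "(f, u 0) \<in> spectral_integral ?M E (\<lambda>r. 1)"
    by (auto simp: unitary_group_def functional_calculus_def)
  interpret spectral_measure ?M E
    using E by unfold_locales (simp add: spectral_resolution_def)
  have "AE x in ?M. u 0 x = f x"
    using spectral_integral_one[OF fu] by (simp add: L2_eq_def)
  moreover have "AE x in ?M. continuous_on UNIV (\<lambda>t. u t x)"
    using u by (simp add: continuous_representative_def)
  ultimately show "AE x in ?M. ((\<lambda>t. u t x) \<longlongrightarrow> f x) (at_right 0)"
  proof eventually_elim
    case (elim x)
    have "((\<lambda>t. u t x) \<longlongrightarrow> u 0 x) (at 0)"
      using elim(2) by (simp add: continuous_on_def)
    then have "((\<lambda>t. u t x) \<longlongrightarrow> f x) (at 0)"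
      using elim(1) by simp
    then show ?case
      by (rule tendsto_mono[OF at_le[OF subset_UNIV]])
  qed
qed

end
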